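(* Let $\mathcal{F}=\{f_1,f_2,\dots\}$ be a countable family of continuous, non-singular functions $\mathbb{R}\to\mathbb{R}$. For every $r\in(0,1]$ the generalized Sierpinski number $\xi_{\mathcal{F}}(r):=\inf\{x\in[0,1]: x\notin U_{\mathcal{F}}(r)\}$ is a well-defined element of $[0,1)$ and is $\mathcal{F}$-normal, i.e. $f(\xi_{\mathcal{F}}(r))$ is normal for every $f\in\mathcal{F}$.
   Context: $\mu$ is Lebesgue measure. A real number is (absolutely) normal if in every integer base $b\ge2$ every finite word $w$ over $\{0,\dots,b-1\}$ occurs in its base-$b$ expansion with asymptotic frequency $b^{-|w|}$. A function $\varphi$ is non-singular if $\varphi^{-1}(N)$ is a null set for every null set $N$. For measurable $f:[0,1]\to\mathbb{R}$ the stretch function is $s_f(\delta):=\sup\{\mu(f^{-1}(A)): A\subset\mathbb{R}\text{ Borel},\ \mu(A)\le\delta\}$ ($f^{-1}(A)\subset[0,1]$); for $f_k\in\mathcal{F}$, $s_{f_k}$ is the stretch function of the restriction of $f_k$ to $[0,1]$, and $s_{f_k}^{-1}$ denotes its generalized inverse $s_{f_k}^{-1}(y):=\sup\{t\ge0: s_{f_k}(t)\le y\}$. Sierpinski cover: for integers $b\ge2$, $m,n\ge1$, $d\in\{0,\dots,b-1\}$, with $C_d(q_1,\dots,q_n):=\#\{j:q_j=d\}$, let $U_{b,m,n,d}:=\bigcup\big(\sum_{j=1}^nq_jb^{-j}+b^{-n},\sum_{j=1}^nq_jb^{-j}+2b^{-n}\big)$ over all $(q_1,\dots,q_n)\in\{0,\dots,b-1\}^n$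 with $|C_d(q_1,\dots,q_n)/n-1/b|\ge1/m$; $n_{m,b}(r):=\lfloor24m^6b^2/r\rfloor+2$; $U(r):=\bigcup_{b\ge2}\bigcup_{m\ge1}\bigcup_{n\ge n_{m,b}(r)}\bigcup_{d=0}^{b-1}U_{b,m,n,d}$; $U^+(r):=\bigcup_{z\in\mathbb{Z}}(z+U(r/2^{|z|+2}))$. Finally $U_{\mathcal{F}}(r):=\bigcup_{k\ge1}f_k^{-1}\big(U^+(s_{f_k}^{-1}(2^{-k}r))\big)$.
   Formalization: The intervals in U_{b,m,n,d} are taken as (Σq_j b^{-j} − b^{-n}, Σq_j b^{-j} + 2b^{-n}), with − in place of + at the left end; with + no integer is ever covered, so for f_k(x)=kx one gets ξ=0, which is not normal. *)

theory Defs
  imports "HOL-Analysis.Analysis"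
begin

(* The j-th digit (j \<ge> 1) after the point of the base-b expansion of x, read off the fractional
   part x - \<lfloor>x\<rfloor>; the integer part has no influence on asymptotic frequencies. *)
definition base_digit :: "nat \<Rightarrow> real \<Rightarrow> nat \<Rightarrow> nat" where
  "base_digit b x j = nat (\<lfloor>frac x * real b ^ j\<rfloor> mod int b)"

definition word_occurrences :: "nat \<Rightarrow> real \<Rightarrow> nat list \<Rightarrow> nat \<Rightarrow> nat" where
  "word_occurrences b x w n =
     card {i \<in> {1..n}. \<forall>j < length w. base_digit b x (i + j) = w ! j}"

definition normal_real :: "real \<Rightarrow> bool" where
  "normal_real x \<longleftrightarrow>
     (\<forall>b \<ge> 2. \<forall>w. set w \<subseteq> {..<b} \<longrightarrow>
        (\<lambda>n. real (word_occurrences b x w n) / real n) \<longlonglongrightarrow> 1 / real b ^ length w)"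

definition family_normal :: "(real \<Rightarrow> real) set \<Rightarrow> real \<Rightarrow> bool" where
  "family_normal F x \<longleftrightarrow> (\<forall>f \<in> F. normal_real (f x))"

definition nonsingular :: "(real \<Rightarrow> real) \<Rightarrow> bool" where
  "nonsingular f \<longleftrightarrow> (\<forall>N \<in> null_sets lebesgue. f -` N \<in> null_sets lebesgue)"

definition stretch :: "(real \<Rightarrow> real) \<Rightarrow> real \<Rightarrow> real" where
  "stretch f \<delta> =
     Sup {measure lebesgue (f -` A \<inter> {0..1}) | A.
            A \<in> sets borel \<and> emeasure lborel A \<le> ennreal \<delta>}"

(* For f continuous and non-singular and 0 < y < 1 the set is nonempty (it contains 0) and bounded
   above (by the length of the interval f ` {0..1}), so the real-valued supremum is the genuine one. *)
definition stretch_inv :: "(real \<Rightarrow> real) \<Rightarrow> real \<Rightarrow> real" where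
  "stretch_inv f y = Sup {t. 0 \<le> t \<and> stretch f t \<le> y}"

definition digit_count :: "nat \<Rightarrow> nat \<Rightarrow> (nat \<Rightarrow> nat) \<Rightarrow> nat" where
  "digit_count d n q = card {j \<in> {1..n}. q j = d}"

definition word_value :: "nat \<Rightarrow> nat \<Rightarrow> (nat \<Rightarrow> nat) \<Rightarrow> real" where
  "word_value b n q = (\<Sum>j=1..n. real (q j) / real b ^ j)"

(* The left endpoint is word_value - b^(-n), as in Sierpinski's construction.  With + b^(-n) every
   interval would have adjacent b-adic endpoints, no integer would ever be covered, and for the
   identity function the resulting number would be 0. *)
definition sier_block :: "nat \<Rightarrow> nat \<Rightarrow> nat \<Rightarrow> nat \<Rightarrow> real set" where
  "sier_block b m n d =
     (\<Union>q \<in> {q \<in> {1..n} \<rightarrow>\<^sub>E {..<b}. \<bar>real (digit_count d n q) / real n - 1 / real b\<bar> \<ge> 1 / real m}.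
        {word_value b n q - 1 / real b ^ n <..< word_value b n q + 2 / real b ^ n})"

definition sier_start :: "nat \<Rightarrow> nat \<Rightarrow> real \<Rightarrow> nat" where
  "sier_start m b r = nat \<lfloor>24 * real m ^ 6 * real b ^ 2 / r\<rfloor> + 2"

definition sier_cover :: "real \<Rightarrow> real set" where
  "sier_cover r =
     (\<Union>b \<in> {2..}. \<Union>m \<in> {1..}. \<Union>n \<in> {sier_start m b r..}. \<Union>d \<in> {..<b}. sier_block b m n d)"

definition sier_cover_plus :: "real \<Rightarrow> real set" where
  "sier_cover_plus r =
     (\<Union>z::int. (\<lambda>x. of_int z + x) ` sier_cover (r / 2 ^ (nat \<bar>z\<bar> + 2)))"

(* The family is enumerated as f 1, f 2, ...; the value f 0 is not used. *)
definition family_cover :: "(nat \<Rightarrow> real \<Rightarrow> real) \<Rightarrow> real \<Rightarrow> real set" where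
  "family_cover f r = (\<Union>k \<in> {1..}. f k -` sier_cover_plus (stretch_inv (f k) (r / 2 ^ k)))"

definition sierpinski_number :: "(nat \<Rightarrow> real \<Rightarrow> real) \<Rightarrow> real \<Rightarrow> real" where
  "sierpinski_number f r = Inf {x \<in> {0..1}. x \<notin> family_cover f r}"

end

theory Submission
  imports Defs
begin

text \<open>
  A fourth-moment estimate shows that the fraction of words of length n over b digits in which some
  digit has frequency off by at least 1/m is O(m^4 / n^2). The choice of the starting index makes
  the covering sets of total measure at most r/2, and at most s/2 for the integer-translated cover with
  parameter s. A point outside such a cover is simply normal to every base, and simple
  normality to all powers of b gives the frequency of every base-b word, because only a
  fraction k/L of the positions lets a word of length k straddle two consecutive blocks of L digits.

  Non-singularity makes the stretch function tend to 0 at 0, so its generalized inverse is positive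
  and the preimage of the k-th cover has measure at most r / 2^k in the unit interval. These preimages
  are open and dense, hence the first two overlap in positive measure, and the union has measure
  strictly less than 1 even if r = 1. The complement is closed, so it contains its infimum.
\<close>

section \<open>The fourth moment of digit counts\<close>

text \<open>Splitting off the last digit: one of its \<open>b\<close> values raises the count, the
  other \<open>b - 1\<close> leave it unchanged. With \<open>G\<close> arbitrary, this yields the
  recursion in \<open>n\<close> for every moment at once.\<close>

lemma sum_PiE_digit_count:
  fixes G :: "real \<Rightarrow> real"
  assumes "d < b"
  shows "(\<Sum>q\<in>{1..Suc n} \<rightarrow>\<^sub>E {..<b}. G (real (digit_count d (Suc n) q)))
       = (\<Sum>q\<in>{1..n} \<rightarrow>\<^sub>E {..<b}. G (real (digit_count d n q) + 1)
            + (real b - 1) * G (real (digit_count d n q)))"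
proof -
  have ins: "{1..Suc n} = insert (Suc n) {1..n}" by auto
  have count: "digit_count d (Suc n) (q(Suc n := y)) = digit_count d n q + (if y = d then 1 else 0)"
    for q y
  proof -
    have "{j \<in> {1..Suc n}. (q(Suc n := y)) j = d}
        = {j \<in> {1..n}. q j = d} \<union> (if y = d then {Suc n} else {})"
      by auto
    then show ?thesis by (auto simp: digit_count_def)
  qed
  have "(\<Sum>q\<in>{1..Suc n} \<rightarrow>\<^sub>E {..<b}. G (real (digit_count d (Suc n) q)))
      = (\<Sum>(y, q)\<in>{..<b} \<times> ({1..n} \<rightarrow>\<^sub>E {..<b}). G (real (digit_count d n q + (if y = d then 1 else 0))))"
    unfolding ins PiE_insert_eq
    by (subst sum.reindex) (auto intro!: inj_combinator sum.cong simp: count)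
  also have "\<dots> = (\<Sum>q\<in>{1..n} \<rightarrow>\<^sub>E {..<b}. \<Sum>y<b. G (real (digit_count d n q + (if y = d then 1 else 0))))"
    by (subst sum.swap) (simp add: sum.cartesian_product)
  also have "\<dots> = (\<Sum>q\<in>{1..n} \<rightarrow>\<^sub>E {..<b}. G (real (digit_count d n q) + 1)
            + (real b - 1) * G (real (digit_count d n q)))"
  proof (rule sum.cong[OF refl])
    fix q
    have "(\<Sum>y<b. G (real (digit_count d n q + (if y = d then 1 else 0))))
      = G (real (digit_count d n q) + 1) + (\<Sum>y\<in>{..<b} - {d}. G (real (digit_count d n q)))"
      using assms by (subst sum.remove[of _ d]) (auto intro!: sum.cong simp: add.commute)
    also have "(\<Sum>y\<in>{..<b} - {d}. G (real (digit_count d n q))) = (real b - 1) * G (real (digit_count d n q))"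
      using assms by (simp add: of_nat_diff)
    finally show "(\<Sum>y<b. G (real (digit_count d n q + (if y = d then 1 else 0))))
       = G (real (digit_count d n q) + 1) + (real b - 1) * G (real (digit_count d n q))" .
  qed
  finally show ?thesis .
qed

text \<open>\<open>M k n\<close> is \<open>b ^ n\<close> times the \<open>k\<close>-th central
  moment of a binomial variable with parameters \<open>n\<close> and \<open>p\<close>, and
  \<open>\<sigma>\<close> is the variance of one trial. The three claims are proved jointly because
  the recursion for the fourth moment involves the first two; the third drops out, since a single
  trial is centred.\<close>

lemma digit_count_moments:
  fixes b d n :: nat
  defines "p \<equiv> 1 / real b"
  defines "\<sigma> \<equiv> p * (1 - p)"
  defines "M \<equiv> \<lambda>k n. \<Sum>q\<in>{1..n} \<rightarrow>\<^sub>E {..<b}. (real (digit_count d n q) - real n * p) ^ k"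
  assumes "d < b"
  shows "M 1 n = 0 \<and> M 2 n = real n * \<sigma> * real b ^ n
       \<and> M 4 n \<le> (3 * (real n)\<^sup>2 * \<sigma>\<^sup>2 + real n * \<sigma>) * real b ^ n"
proof (induction n)
  case 0
  then show ?case by (simp add: M_def digit_count_def)
next
  case (Suc n)
  have b0: "real b > 0" and b1: "real b \<ge> 1" using assms(4) by auto
  have p: "real b * p = 1" using b0 by (simp add: p_def)
  have p01: "0 \<le> p" "p \<le> 1" using b1 by (auto simp: p_def)
  then have s0: "0 \<le> \<sigma>" by (simp add: \<sigma>_def)
  have M0: "M 0 n = real b ^ n"
    by (simp add: M_def card_PiE)
  \<comment> \<open>A new digit adds a centred Bernoulli increment: \<open>1 - p\<close> with weight
    \<open>p\<close>, and \<open>- p\<close> with weight \<open>1 - p\<close>. The factor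
    \<open>b\<close> counts the choices of that digit.\<close>
  have step: "M k (Suc n) = real b * (\<Sum>q\<in>{1..n} \<rightarrow>\<^sub>E {..<b}.
       p * ((real (digit_count d n q) - real n * p) + (1 - p)) ^ k
       + (1 - p) * ((real (digit_count d n q) - real n * p) - p) ^ k)" for k
  proof -
    have "M k (Suc n) = (\<Sum>q\<in>{1..n} \<rightarrow>\<^sub>E {..<b}. (real (digit_count d n q) + 1 - real (Suc n) * p) ^ k
            + (real b - 1) * (real (digit_count d n q) - real (Suc n) * p) ^ k)"
      unfolding M_def by (rule sum_PiE_digit_count[OF assms(4), of "\<lambda>c. (c - real (Suc n) * p) ^ k"])
    also have "\<dots> = (\<Sum>q\<in>{1..n} \<rightarrow>\<^sub>E {..<b}.
       real b * (p * ((real (digit_count d n q) - real n * p) + (1 - p)) ^ k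
       + (1 - p) * ((real (digit_count d n q) - real n * p) - p) ^ k))"
    proof (rule sum.cong[OF refl])
      fix q
      let ?c = "real (digit_count d n q)"
      have 1: "?c + 1 - real (Suc n) * p = (?c - real n * p) + (1 - p)"
        and 2: "?c - real (Suc n) * p = (?c - real n * p) - p" by (auto simp: algebra_simps)
      have 3: "real b * (p * x + (1 - p) * y) = x + (real b - 1) * y" for x y :: real
        using p by algebra
      show "(?c + 1 - real (Suc n) * p) ^ k + (real b - 1) * (?c - real (Suc n) * p) ^ k
        = real b * (p * ((?c - real n * p) + (1 - p)) ^ k + (1 - p) * ((?c - real n * p) - p) ^ k)"
        unfolding 1 2 3 ..
    qed
    finally show ?thesis by (simp add: sum_distrib_left)
  qed
  have "M 1 (Suc n) = real b * M 1 n"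
    unfolding step by (simp add: M_def algebra_simps)
  then have m1: "M 1 (Suc n) = 0" using Suc by simp
  \<comment> \<open>The linear term vanishes because the increment has mean zero. The constant is
    written with \<open>u ^ 0\<close> so that summation over words produces
    \<open>M 0 n\<close>.\<close>
  have e2: "p * (u + (1 - p)) ^ 2 + (1 - p) * (u - p) ^ 2 = u ^ 2 + \<sigma> * u ^ 0" for u :: real
    unfolding \<sigma>_def by (simp add: algebra_simps power2_eq_square)
  have m2: "M 2 (Suc n) = real b * (M 2 n + \<sigma> * M 0 n)"
    unfolding step e2 by (simp only: M_def sum.distrib sum_distrib_left)
  \<comment> \<open>\<open>\<kappa>\<close> and \<open>\<nu>\<close> are the third and fourth
    central moments of a single trial. Only \<open>\<nu>\<close> needs an estimate, because
    \<open>\<kappa>\<close> is multiplied by the vanishing first moment.\<close>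
  define \<kappa> where "\<kappa> = p * (1 - p) ^ 3 - (1 - p) * p ^ 3"
  define \<nu> where "\<nu> = p * (1 - p) ^ 4 + (1 - p) * p ^ 4"
  have e4: "p * (u + (1 - p)) ^ 4 + (1 - p) * (u - p) ^ 4
      = u ^ 4 + 6 * \<sigma> * u ^ 2 + 4 * \<kappa> * u ^ 1 + \<nu> * u ^ 0" for u :: real
    unfolding \<sigma>_def \<kappa>_def \<nu>_def by (simp add: field_simps) algebra
  have m4: "M 4 (Suc n) = real b * (M 4 n + 6 * \<sigma> * M 2 n + 4 * \<kappa> * M 1 n + \<nu> * M 0 n)"
    unfolding step e4 by (simp only: M_def sum.distrib sum_distrib_left)
  have "\<nu> = \<sigma> * ((1 - p) ^ 3 + p ^ 3)" unfolding \<nu>_def \<sigma>_def by algebra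
  also have "(1 - p) ^ 3 + p ^ 3 = 1 - 3 * \<sigma>" unfolding \<sigma>_def by algebra
  also have "\<sigma> * (1 - 3 * \<sigma>) \<le> \<sigma>" using s0 by (simp add: algebra_simps)
  finally have nu: "\<nu> \<le> \<sigma>" .
  have "M 2 (Suc n) = real (Suc n) * \<sigma> * real b ^ Suc n"
    using m2 M0 Suc by (simp add: algebra_simps)
  moreover have "M 4 (Suc n) \<le> real b * ((3 * (real n)\<^sup>2 * \<sigma>\<^sup>2 + real n * \<sigma>) * real b ^ n
       + 6 * \<sigma> * (real n * \<sigma> * real b ^ n) + \<sigma> * real b ^ n)"
  proof -
    have "\<nu> * real b ^ n \<le> \<sigma> * real b ^ n" using nu by (intro mult_right_mono) auto
    moreover have "M 1 n = 0" "M 2 n = real n * \<sigma> * real b ^ n"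
      "M 4 n \<le> (3 * (real n)\<^sup>2 * \<sigma>\<^sup>2 + real n * \<sigma>) * real b ^ n"
      using Suc by auto
    ultimately show ?thesis unfolding m4 M0 by (intro mult_left_mono) simp_all
  qed
  \<comment> \<open>This uses \<open>3 * n^2 + 6 * n = 3 * ((n + 1)^2 - 1)\<close>.\<close>
  moreover have "\<dots> = (3 * ((real (Suc n))\<^sup>2 - 1) * \<sigma>\<^sup>2 + real (Suc n) * \<sigma>) * real b ^ Suc n"
    by (simp add: algebra_simps power2_eq_square)
  moreover have "\<dots> \<le> (3 * (real (Suc n))\<^sup>2 * \<sigma>\<^sup>2 + real (Suc n) * \<sigma>) * real b ^ Suc n"
    using b0 s0 by (intro mult_right_mono add_mono) auto
  ultimately show ?case using m1 by linarith
qed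

text \<open>Markov's inequality for the fourth power of the centred count. The factor
  \<open>b\<close> on the left prepares for the union over all \<open>b\<close> digits: it is
  absorbed by the variance, which is at most \<open>1 / b\<close>.\<close>

lemma card_unbalanced_words:
  fixes b m n d :: nat
  assumes "d < b" "2 \<le> b" "1 \<le> m" "2 \<le> n"
  shows "real b * real (card {q \<in> {1..n} \<rightarrow>\<^sub>E {..<b}. \<bar>real (digit_count d n q) / real n - 1 / real b\<bar> \<ge> 1 / real m})
     \<le> 2 * real m ^ 4 / (real n)\<^sup>2 * real b ^ n"
proof -
  define p where "p = 1 / real b"
  define \<sigma> where "\<sigma> = p * (1 - p)"
  let ?P = "{1..n} \<rightarrow>\<^sub>E {..<b}"
  let ?B = "{q \<in> ?P. \<bar>real (digit_count d n q) / real n - 1 / real b\<bar> \<ge> 1 / real m}"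
  have fin: "finite ?P" by (intro finite_PiE) auto
  have "real (card ?B) * (real n / real m) ^ 4 = (\<Sum>q\<in>?B. (real n / real m) ^ 4)" by simp
  also have "\<dots> \<le> (\<Sum>q\<in>?B. (real (digit_count d n q) - real n * p) ^ 4)"
  proof (rule sum_mono)
    fix q assume "q \<in> ?B"
    then have "1 / real m \<le> \<bar>real (digit_count d n q) / real n - 1 / real b\<bar>" by simp
    then have "real n * (1 / real m) \<le> real n * \<bar>real (digit_count d n q) / real n - 1 / real b\<bar>"
      by (intro mult_left_mono) auto
    also have "\<dots> = \<bar>real n * (real (digit_count d n q) / real n - 1 / real b)\<bar>"
      by (simp add: abs_mult)
    also have "real n * (real (digit_count d n q) / real n - 1 / real b) = real (digit_count d n q) - real n * p"
      using assms by (simp add: p_def field_simps)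
    finally have "(real n / real m) ^ 4 \<le> \<bar>real (digit_count d n q) - real n * p\<bar> ^ 4"
      by (intro power_mono) auto
    then show "(real n / real m) ^ 4 \<le> (real (digit_count d n q) - real n * p) ^ 4"
      by (simp add: power_even_abs)
  qed
  also have "\<dots> \<le> (\<Sum>q\<in>?P. (real (digit_count d n q) - real n * p) ^ 4)"
    by (rule sum_mono2[OF fin]) (auto simp: zero_le_even_power)
  also have "\<dots> \<le> (3 * (real n)\<^sup>2 * \<sigma>\<^sup>2 + real n * \<sigma>) * real b ^ n"
    using digit_count_moments[OF assms(1), of n] unfolding \<sigma>_def p_def by blast
  finally have 1: "real (card ?B) * (real n / real m) ^ 4 \<le> (3 * (real n)\<^sup>2 * \<sigma>\<^sup>2 + real n * \<sigma>) * real b ^ n" .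
  have s: "0 \<le> \<sigma>" "\<sigma> \<le> 1 / real b" "p \<le> 1 / 2" "real b * p = 1"
    using assms by (auto simp: \<sigma>_def p_def field_simps)
  have bs: "real b * \<sigma> \<le> 1" using s(2) assms by (simp add: field_simps)
  have s2: "\<sigma> \<le> 1 / 4"
    using zero_le_power2[of "p - 1/2"] unfolding \<sigma>_def by (simp add: power2_eq_square algebra_simps)
  \<comment> \<open>One factor \<open>\<sigma>\<close> cancels \<open>b\<close>, the other is
    bounded by \<open>1 / 4\<close>.\<close>
  have "real b * (3 * (real n)\<^sup>2 * \<sigma>\<^sup>2 + real n * \<sigma>) = (real b * \<sigma>) * (3 * (real n)\<^sup>2 * \<sigma> + real n)"
    by (simp add: power2_eq_square algebra_simps)
  also have "\<dots> \<le> 1 * (3 * (real n)\<^sup>2 * (1/4) + real n)"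
    using bs s s2 by (intro mult_mono add_mono) auto
  also have "\<dots> = 3 / 4 * (real n)\<^sup>2 + real n" by simp
  also have "\<dots> \<le> 2 * (real n)\<^sup>2"
  proof -
    have "2 * real n \<le> real n * real n" "2 \<le> real n" using assms by (auto intro: mult_right_mono)
    then show ?thesis unfolding power2_eq_square using assms by linarith
  qed
  finally have 2: "real b * (3 * (real n)\<^sup>2 * \<sigma>\<^sup>2 + real n * \<sigma>) \<le> 2 * (real n)\<^sup>2" .
  have "real b * real (card ?B) * (real n / real m) ^ 4
      \<le> real b * ((3 * (real n)\<^sup>2 * \<sigma>\<^sup>2 + real n * \<sigma>) * real b ^ n)"
    using mult_left_mono[OF 1, of "real b"] by (simp add: mult.assoc)
  also have "\<dots> \<le> 2 * (real n)\<^sup>2 * real b ^ n"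
    using mult_right_mono[OF 2, of "real b ^ n"] by (simp add: mult.assoc)
  finally have "real b * real (card ?B) \<le> 2 * (real n)\<^sup>2 * real b ^ n / (real n / real m) ^ 4"
    using assms by (subst pos_le_divide_eq) auto
  also have "\<dots> = 2 * real m ^ 4 / (real n)\<^sup>2 * real b ^ n"
    using assms by (simp add: field_simps power2_eq_square power4_eq_xxxx)
  finally show ?thesis .
qed

section \<open>Measure of the covers\<close>

lemma emeasure_UN_le_sums:
  fixes A :: "nat \<Rightarrow> 'a set" and g :: "nat \<Rightarrow> real"
  assumes "\<And>i. A i \<in> sets M" "\<And>i. emeasure M (A i) \<le> ennreal (g i)" "\<And>i. 0 \<le> g i" "g sums G"
  shows "emeasure M (\<Union>i. A i) \<le> ennreal G"
proof -
  have "emeasure M (\<Union>i. A i) \<le> (\<Sum>i. emeasure M (A i))"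
    using assms(1) by (intro emeasure_subadditive_countably) auto
  also have "\<dots> \<le> (\<Sum>i. ennreal (g i))"
    using assms(2) by (intro suminf_le) auto
  also have "\<dots> = ennreal G"
    using assms(3,4) by (rule suminf_ennreal_eq)
  finally show ?thesis .
qed

text \<open>Serves the unions over \<open>n\<close>, \<open>m\<close> and \<open>b\<close> alike: in
  each, the bound of order one over the square of the index is majorised by a telescoping
  difference, so the total can be read off at the starting index.\<close>

lemma emeasure_UN_le_telescope:
  fixes A :: "nat \<Rightarrow> 'a set" and h :: "nat \<Rightarrow> real"
  assumes "\<And>i. a \<le> i \<Longrightarrow> A i \<in> sets M"
    and "\<And>i. a \<le> i \<Longrightarrow> emeasure M (A i) \<le> ennreal (h i - h (Suc i))"
    and "\<And>i. a \<le> i \<Longrightarrow> h (Suc i) \<le> h i" and "h \<longlonglongrightarrow> 0"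
  shows "emeasure M (\<Union>i\<in>{a..}. A i) \<le> ennreal (h a)"
proof -
  have "(\<Union>i\<in>{a..}. A i) = (\<Union>i. A (i + a))"
    by (auto simp: le_iff_add add.commute) (metis add.commute atLeast_iff le_add1)
  moreover have "emeasure M (\<Union>i. A (i + a)) \<le> ennreal (h a)"
  proof (rule emeasure_UN_le_sums[where g = "\<lambda>i. h (i + a) - h (Suc i + a)"])
    have "(\<lambda>i. h (i + a)) \<longlonglongrightarrow> 0" using assms(4) by (rule LIMSEQ_ignore_initial_segment)
    from telescope_sums'[OF this] show "(\<lambda>i. h (i + a) - h (Suc i + a)) sums h a" by simp
  qed (use assms in auto)
  ultimately show ?thesis by simp
qed

lemma open_sier_block: "open (sier_block b m n d)"
  unfolding sier_block_def by auto

lemma open_sier_cover: "open (sier_cover r)"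
  unfolding sier_cover_def by (intro open_UN ballI open_sier_block)

lemma open_sier_cover_plus: "open (sier_cover_plus r)"
  unfolding sier_cover_plus_def by (intro open_UN ballI open_translation open_sier_cover)

text \<open>Every interval has length \<open>3 / b ^ n\<close>, and there are at most
  \<open>2 * m^4 / n^2 * b^n / b\<close> unbalanced words.\<close>

lemma emeasure_sier_block:
  assumes "d < b" "2 \<le> b" "1 \<le> m" "2 \<le> n"
  shows "emeasure lborel (sier_block b m n d) \<le> ennreal (6 * real m ^ 4 / (real n)\<^sup>2 / real b)"
proof -
  let ?B = "{q \<in> {1..n} \<rightarrow>\<^sub>E {..<b}. \<bar>real (digit_count d n q) / real n - 1 / real b\<bar> \<ge> 1 / real m}"
  let ?I = "\<lambda>q. {word_value b n q - 1 / real b ^ n <..< word_value b n q + 2 / real b ^ n}"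
  have fin: "finite ?B" by (intro finite_subset[OF _ finite_PiE[of "{1..n}" "\<lambda>_. {..<b}"]]) auto
  have b0: "real b ^ n > 0" using assms by simp
  have I: "emeasure lborel (?I q) = ennreal (3 / real b ^ n)" for q
  proof -
    have "word_value b n q - 1 / real b ^ n \<le> word_value b n q + 2 / real b ^ n"
      using b0 by (simp add: field_simps)
    then show ?thesis by (simp add: emeasure_lborel_Ioo add_divide_distrib[symmetric])
  qed
  have "emeasure lborel (sier_block b m n d) \<le> (\<Sum>q\<in>?B. emeasure lborel (?I q))"
    unfolding sier_block_def using fin by (intro emeasure_subadditive_finite) auto
  also have "\<dots> = ennreal (real (card ?B) * (3 / real b ^ n))"
    using b0 by (simp only: I sum_constant ennreal_of_nat_eq_real_of_nat) (simp flip: ennreal_mult)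
  also have "\<dots> \<le> ennreal (6 * real m ^ 4 / (real n)\<^sup>2 / real b)"
  proof (rule ennreal_leI)
    have "real (card ?B) \<le> 2 * real m ^ 4 / (real n)\<^sup>2 * real b ^ n / real b"
      using card_unbalanced_words[OF assms] assms by (simp add: field_simps)
    then have "real (card ?B) * (3 / real b ^ n) \<le> 2 * real m ^ 4 / (real n)\<^sup>2 * real b ^ n / real b * (3 / real b ^ n)"
      using b0 by (intro mult_right_mono) auto
    also have "\<dots> = 6 * real m ^ 4 / (real n)\<^sup>2 / real b" using b0 by (simp add: field_simps)
    finally show "real (card ?B) * (3 / real b ^ n) \<le> 6 * real m ^ 4 / (real n)\<^sup>2 / real b" .
  qed
  finally show ?thesis .
qed

text \<open>The unions are estimated from the inside out. The digits give
  \<open>6 * m^4 / n^2\<close>, the lengths from \<open>sier_start\<close> on give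
  \<open>r / (4 * m^2 * b^2)\<close>, all tolerances give \<open>r / (2 * b^2)\<close> as the
  inverse squares from 1 sum to at most 2, and all bases give \<open>r / 2\<close> as those from 2
  sum to at most 1.\<close>

lemma emeasure_sier_cover:
  assumes r: "0 < r"
  shows "emeasure lborel (sier_cover r) \<le> ennreal (r / 2)"
proof -
  have sets: "S \<in> sets lborel" if "open S" for S :: "real set" using that by simp
  have digits: "emeasure lborel (\<Union>d<b. sier_block b m n d) \<le> ennreal (6 * real m ^ 4 / (real n)\<^sup>2)"
    if "2 \<le> b" "1 \<le> m" "2 \<le> n" for b m n
  proof -
    have "emeasure lborel (\<Union>d<b. sier_block b m n d) \<le> (\<Sum>d<b. emeasure lborel (sier_block b m n d))"
      by (intro emeasure_subadditive_finite) (auto intro: borel_open open_sier_block)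
    also have "\<dots> \<le> (\<Sum>d<b. ennreal (6 * real m ^ 4 / (real n)\<^sup>2 / real b))"
      using that by (intro sum_mono emeasure_sier_block) auto
    also have "\<dots> = ennreal (\<Sum>d<b. 6 * real m ^ 4 / (real n)\<^sup>2 / real b)" by (rule sum_ennreal) simp
    also have "(\<Sum>d<b. 6 * real m ^ 4 / (real n)\<^sup>2 / real b) = 6 * real m ^ 4 / (real n)\<^sup>2"
      using that by simp
    finally show ?thesis .
  qed
  have lengths: "emeasure lborel (\<Union>n\<in>{sier_start m b r..}. \<Union>d<b. sier_block b m n d)
      \<le> ennreal (r / (4 * (real m)\<^sup>2 * (real b)\<^sup>2))" if bm: "2 \<le> b" "1 \<le> m" for b m
  proof -
    let ?N = "sier_start m b r"
    let ?h = "\<lambda>i. 6 * real m ^ 4 * (1 / (real i - 1))"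
    \<comment> \<open>The summand 2 in \<open>sier_start\<close> keeps the denominator
      \<open>i - 1\<close> of \<open>?h\<close> positive.\<close>
    have N2: "2 \<le> ?N" by (simp add: sier_start_def)
    have dec: "6 * real m ^ 4 / (real i)\<^sup>2 \<le> ?h i - ?h (Suc i)" if "2 \<le> i" for i
    proof -
      have "1 / (real i)\<^sup>2 \<le> 1 / (real i - 1) - 1 / real i"
        using that by (simp add: field_simps power2_eq_square)
      then have "6 * real m ^ 4 * (1 / (real i)\<^sup>2) \<le> 6 * real m ^ 4 * (1 / (real i - 1) - 1 / real i)"
        by (intro mult_left_mono) auto
      then show ?thesis by (simp add: right_diff_distrib)
    qed
    have "emeasure lborel (\<Union>n\<in>{?N..}. \<Union>d<b. sier_block b m n d) \<le> ennreal (?h ?N)"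
    proof (rule emeasure_UN_le_telescope)
      fix i assume i: "?N \<le> i"
      show "(\<Union>d<b. sier_block b m i d) \<in> sets lborel"
        by (intro sets open_UN ballI open_sier_block)
      show "emeasure lborel (\<Union>d<b. sier_block b m i d) \<le> ennreal (?h i - ?h (Suc i))"
        using digits[of b m i] dec[of i] bm i N2 by (meson ennreal_leI order_trans)
      have "0 \<le> 6 * real m ^ 4 / (real i)\<^sup>2" by simp
      then show "?h (Suc i) \<le> ?h i" using dec[of i] i N2 by linarith
    next
      have "(\<lambda>i. 1 / (real i - 1)) \<longlonglongrightarrow> 0"
      proof (rule LIMSEQ_offset[where k = 1])
        show "(\<lambda>i. 1 / (real (i + 1) - 1)) \<longlonglongrightarrow> 0" using lim_1_over_n by simp
      qed
      from tendsto_mult_right_zero[OF this] show "?h \<longlonglongrightarrow> 0" .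
    qed
    also have "ennreal (?h ?N) \<le> ennreal (r / (4 * (real m)\<^sup>2 * (real b)\<^sup>2))"
    proof (rule ennreal_leI)
      let ?c = "24 * real m ^ 6 * (real b)\<^sup>2 / r"
      have c: "0 < ?c" using bm r by simp
      \<comment> \<open>After subtracting 1 there remains the floor of \<open>?c\<close> plus 1,
        which exceeds \<open>?c\<close>. The constant 24 is \<open>6 * 4\<close>, and the sixth
        power of \<open>m\<close> pays for \<open>m^4\<close> and leaves \<open>m^2\<close> for the
        sum over \<open>m\<close>.\<close>
      have "?c \<le> real ?N - 1"
        unfolding sier_start_def using c by (simp add: of_nat_nat) linarith
      then have "?h ?N \<le> 6 * real m ^ 4 * (1 / ?c)"
        using c by (intro mult_left_mono frac_le) auto
      also have "\<dots> = r / (4 * (real m)\<^sup>2 * (real b)\<^sup>2)"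
      proof -
        have "real m ^ 6 = real m ^ 4 * (real m)\<^sup>2" by (simp flip: power_add)
        then show ?thesis using bm r by (simp add: field_simps)
      qed
      finally show "?h ?N \<le> r / (4 * (real m)\<^sup>2 * (real b)\<^sup>2)" .
    qed
    finally show ?thesis .
  qed
  have tolerances: "emeasure lborel (\<Union>m\<in>{1..}. \<Union>n\<in>{sier_start m b r..}. \<Union>d<b. sier_block b m n d)
      \<le> ennreal (r / (2 * (real b)\<^sup>2))" if b: "2 \<le> b" for b
  proof -
    let ?h = "\<lambda>i. r / (2 * (real b)\<^sup>2) * (1 / real i)"
    have dec: "r / (4 * (real i)\<^sup>2 * (real b)\<^sup>2) \<le> ?h i - ?h (Suc i)" if "1 \<le> i" for i
    proof -
      \<comment> \<open>Since \<open>m\<close> starts at 1, the comparison is with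
        \<open>1 / (i * (i + 1))\<close>, at the cost of a factor 2.\<close>
      have "1 / (2 * (real i)\<^sup>2) \<le> 1 / (real i * real (Suc i))"
        using that by (intro frac_le) (auto simp: power2_eq_square algebra_simps add_pos_pos)
      also have "\<dots> = 1 / real i - 1 / real (Suc i)"
        using that by (simp add: divide_simps)
      finally have "1 / (2 * (real i)\<^sup>2) \<le> 1 / real i - 1 / real (Suc i)" .
      then have "r / (2 * (real b)\<^sup>2) * (1 / (2 * (real i)\<^sup>2)) \<le> r / (2 * (real b)\<^sup>2) * (1 / real i - 1 / real (Suc i))"
        using r by (intro mult_left_mono) auto
      moreover have "r / (2 * (real b)\<^sup>2) * (1 / (2 * (real i)\<^sup>2)) = r / (4 * (real i)\<^sup>2 * (real b)\<^sup>2)"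
        by simp
      ultimately show ?thesis by (simp only: right_diff_distrib)
    qed
    have "emeasure lborel (\<Union>m\<in>{1..}. \<Union>n\<in>{sier_start m b r..}. \<Union>d<b. sier_block b m n d) \<le> ennreal (?h 1)"
    proof (rule emeasure_UN_le_telescope)
      fix i :: nat assume i: "1 \<le> i"
      show "(\<Union>n\<in>{sier_start i b r..}. \<Union>d<b. sier_block b i n d) \<in> sets lborel"
        by (intro sets open_UN ballI open_sier_block)
      show "emeasure lborel (\<Union>n\<in>{sier_start i b r..}. \<Union>d<b. sier_block b i n d) \<le> ennreal (?h i - ?h (Suc i))"
        using lengths[of b i] dec[of i] b i by (meson ennreal_leI order_trans)
      have "0 \<le> r / (4 * (real i)\<^sup>2 * (real b)\<^sup>2)" using r by simp
      then show "?h (Suc i) \<le> ?h i" using dec[of i] i by linarith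
    next
      from tendsto_mult_right_zero[OF lim_1_over_n] show "?h \<longlonglongrightarrow> 0" .
    qed
    then show ?thesis by simp
  qed
  let ?h = "\<lambda>i. r / 2 * (1 / (real i - 1))"
  have dec: "r / (2 * (real i)\<^sup>2) \<le> ?h i - ?h (Suc i)" if "2 \<le> i" for i
  proof -
    have "1 / (real i)\<^sup>2 \<le> 1 / (real i - 1) - 1 / real i"
      using that by (simp add: field_simps power2_eq_square)
    then have "r / 2 * (1 / (real i)\<^sup>2) \<le> r / 2 * (1 / (real i - 1) - 1 / real i)"
      using r by (intro mult_left_mono) auto
    then show ?thesis by (simp add: right_diff_distrib)
  qed
  have "emeasure lborel (sier_cover r) \<le> ennreal (?h 2)"
    unfolding sier_cover_def
  proof (rule emeasure_UN_le_telescope)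
    fix i :: nat assume i: "2 \<le> i"
    show "(\<Union>m\<in>{1..}. \<Union>n\<in>{sier_start m i r..}. \<Union>d<i. sier_block i m n d) \<in> sets lborel"
      by (intro sets open_UN ballI open_sier_block)
    show "emeasure lborel (\<Union>m\<in>{1..}. \<Union>n\<in>{sier_start m i r..}. \<Union>d<i. sier_block i m n d)
        \<le> ennreal (?h i - ?h (Suc i))"
      using tolerances[of i] dec[of i] i by (meson ennreal_leI order_trans)
    have "0 \<le> r / (2 * (real i)\<^sup>2)" using r by simp
    then show "?h (Suc i) \<le> ?h i" using dec[of i] i by linarith
  next
    have "(\<lambda>i. 1 / (real i - 1)) \<longlonglongrightarrow> 0"
    proof (rule LIMSEQ_offset[where k = 1])
      show "(\<lambda>i. 1 / (real (i + 1) - 1)) \<longlonglongrightarrow> 0" using lim_1_over_n by simp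
    qed
    from tendsto_mult_right_zero[OF this] show "?h \<longlonglongrightarrow> 0" .
  qed
  then show ?thesis by simp
qed

lemma emeasure_sier_cover_plus:
  assumes s: "0 < s"
  shows "emeasure lborel (sier_cover_plus s) \<le> ennreal (s / 2)"
proof -
  define T where "T = (\<lambda>z::int. (\<lambda>x::real. of_int z + x) ` sier_cover (s / 2 ^ (nat \<bar>z\<bar> + 2)))"
  have openT: "open (T z)" for z unfolding T_def by (intro open_translation open_sier_cover)
  have T: "emeasure lborel (T z) \<le> ennreal (s / 8 * (1 / 2) ^ nat \<bar>z\<bar>)" for z
  proof -
    let ?C = "sier_cover (s / 2 ^ (nat \<bar>z\<bar> + 2))"
    have "emeasure lborel (T z) = emeasure (distr lborel borel ((+) (real_of_int z))) (T z)"
      by (simp add: lborel_distr_plus)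
    also have "\<dots> = emeasure lborel ((+) (real_of_int z) -` T z \<inter> space lborel)"
      using openT by (intro emeasure_distr) auto
    also have "(+) (real_of_int z) -` T z \<inter> space lborel = ?C"
      unfolding T_def by (auto simp: image_iff)
    finally have "emeasure lborel (T z) = emeasure lborel ?C" .
    also have "emeasure lborel ?C \<le> ennreal (s / 2 ^ (nat \<bar>z\<bar> + 2) / 2)"
      using s by (intro emeasure_sier_cover) auto
    also have "s / 2 ^ (nat \<bar>z\<bar> + 2) / 2 = s / 8 * (1 / 2) ^ nat \<bar>z\<bar>"
      by (simp add: field_simps)
    finally show ?thesis .
  qed
  \<comment> \<open>The integers are covered by two half-lines, \<open>c = 1\<close> and
    \<open>c = -1\<close>. Both contain 0, so the weights \<open>(1 / 2) ^ \<bar>z\<bar>\<close> sum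
    to 4 instead of 3, which still suffices for \<open>s / 2\<close>.\<close>
  have half: "emeasure lborel (\<Union>i::nat. T (c * int i)) \<le> ennreal (s / 4)" if c: "\<bar>c\<bar> = 1" for c
  proof (rule emeasure_UN_le_sums[where g = "\<lambda>i. s / 8 * (1 / 2) ^ i"])
    show "T (c * int i) \<in> sets lborel" for i using openT by simp
    show "emeasure lborel (T (c * int i)) \<le> ennreal (s / 8 * (1 / 2) ^ i)" for i
      using T[of "c * int i"] c by (simp add: abs_mult)
    show "0 \<le> s / 8 * (1 / 2) ^ i" for i :: nat using s by simp
    have "(\<lambda>i. s / 8 * (1 / 2) ^ i) sums (s / 8 * (1 / (1 - 1 / 2)))"
      by (intro sums_mult geometric_sums) simp
    then show "(\<lambda>i. s / 8 * (1 / 2) ^ i) sums (s / 4)" by simp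
  qed
  have "sier_cover_plus s = (\<Union>i::nat. T (1 * int i)) \<union> (\<Union>i::nat. T ((-1) * int i))"
  proof -
    have "sier_cover_plus s = (\<Union>z. T z)" by (simp add: sier_cover_plus_def T_def)
    moreover have "\<exists>i. z = 1 * int i \<or> z = (-1) * int i" for z
      by (cases z rule: int_cases2) auto
    ultimately show ?thesis by (simp only:) (auto, metis mult_1 mult_minus1)
  qed
  then have "emeasure lborel (sier_cover_plus s)
      \<le> emeasure lborel (\<Union>i::nat. T (1 * int i)) + emeasure lborel (\<Union>i::nat. T ((-1) * int i))"
    using openT by (simp only:) (intro emeasure_subadditive, auto)
  also have "\<dots> \<le> ennreal (s / 4) + ennreal (s / 4)"
    by (intro add_mono half) auto
  also have "\<dots> = ennreal (s / 2)" using s by (simp flip: ennreal_plus)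
  finally show ?thesis .
qed

section \<open>Digit patterns and block densities\<close>

text \<open>The witness \<open>v\<close> is the number written by \<open>w\<close> in base
  \<open>b\<close>, most significant digit first. An occurrence of a word thus becomes a single
  congruence.\<close>

lemma digit_word_value:
  fixes b :: nat and w :: "nat list"
  assumes "2 \<le> b" "set w \<subseteq> {..<b}"
  shows "\<exists>v < b ^ length w. \<forall>E. (\<forall>t < length w. (E div b ^ (length w - 1 - t)) mod b = w ! t) \<longleftrightarrow> E mod b ^ length w = v"
  using assms(2)
proof (induction w)
  case Nil
  then show ?case by simp
next
  case (Cons a w)
  then obtain v where v: "v < b ^ length w"
    "\<And>E. (\<forall>t < length w. (E div b ^ (length w - 1 - t)) mod b = w ! t) \<longleftrightarrow> E mod b ^ length w = v"
    by auto
  have a: "a < b" using Cons.prems by simp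
  let ?k = "length w"
  have "(\<forall>t < length (a # w). (E div b ^ (length (a # w) - 1 - t)) mod b = (a # w) ! t)
      \<longleftrightarrow> E mod b ^ length (a # w) = b ^ ?k * a + v" for E
  proof -
    have "(\<forall>t < length (a # w). (E div b ^ (length (a # w) - 1 - t)) mod b = (a # w) ! t)
       \<longleftrightarrow> (E div b ^ ?k) mod b = a \<and> E mod b ^ ?k = v"
      by (simp only: length_Cons All_less_Suc2 v(2)[symmetric]) simp
    \<comment> \<open>Uniqueness of quotient and remainder on division by \<open>b ^ ?k\<close>, as
      both remainders are below it.\<close>
    also have "\<dots> \<longleftrightarrow> b ^ ?k * ((E div b ^ ?k) mod b) + E mod b ^ ?k = b ^ ?k * a + v"
    proof
      assume *: "b ^ ?k * ((E div b ^ ?k) mod b) + E mod b ^ ?k = b ^ ?k * a + v"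
      have b0: "b ^ ?k > 0" using assms(1) by simp
      have "(b ^ ?k * ((E div b ^ ?k) mod b) + E mod b ^ ?k) div b ^ ?k = (b ^ ?k * a + v) div b ^ ?k"
        "(b ^ ?k * ((E div b ^ ?k) mod b) + E mod b ^ ?k) mod b ^ ?k = (b ^ ?k * a + v) mod b ^ ?k"
        using * by simp_all
      then show "(E div b ^ ?k) mod b = a \<and> E mod b ^ ?k = v"
        using b0 v(1) by simp
    qed simp
    also have "b ^ ?k * ((E div b ^ ?k) mod b) + E mod b ^ ?k = E mod b ^ length (a # w)"
      by (simp add: mod_mult2_eq mult.commute[of b])
    finally show ?thesis .
  qed
  moreover have "b ^ ?k * a + v < b ^ length (a # w)"
  proof -
    have "b ^ ?k * a + v < b ^ ?k * (a + 1)" using v(1) by simp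
    also have "\<dots> \<le> b ^ ?k * b" using a by (intro mult_left_mono) auto
    finally show ?thesis by (simp add: mult.commute)
  qed
  ultimately show ?case by blast
qed

text \<open>Fixing \<open>k\<close> adjacent digits of an \<open>L\<close>-digit number leaves
  \<open>L - k\<close> digits free: \<open>A\<close> collects the \<open>L - k - s\<close> leading
  ones and \<open>C\<close> the \<open>s\<close> trailing ones.\<close>

lemma card_digit_pattern:
  fixes b k s L v :: nat
  assumes "1 \<le> b" "k + s \<le> L" "v < b ^ k"
  shows "card {D. D < b ^ L \<and> (D div b ^ s) mod b ^ k = v} = b ^ (L - k)"
proof -
  let ?S = "{..<b ^ (L - k - s)} \<times> {..<b ^ s}"
  let ?g = "\<lambda>(A, C). b ^ s * (b ^ k * A + v) + C"
  have b0: "b ^ i > 0" for i using assms by simp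
  have d1: "(b ^ s * (b ^ k * A + v) + C) div b ^ s = b ^ k * A + v" if "C < b ^ s" for A C
    using that b0[of s] by simp
  have d2: "(b ^ k * A + v) div b ^ k = A" for A using assms(3) b0[of k] by simp
  have "inj_on ?g ?S"
  proof (rule inj_onI, clarsimp)
    fix A C A' C'
    assume C: "C < b ^ s" "C' < b ^ s" and eq: "b ^ s * (b ^ k * A + v) + C = b ^ s * (b ^ k * A' + v) + C'"
    have "b ^ k * A + v = b ^ k * A' + v" using d1[OF C(1), of A] d1[OF C(2), of A'] eq by metis
    then have "A = A'" using d2[of A] d2[of A'] by metis
    then show "A = A' \<and> C = C'" using eq by simp
  qed
  moreover have "?g ` ?S = {D. D < b ^ L \<and> (D div b ^ s) mod b ^ k = v}"
  proof (intro equalityI subsetI)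
    fix D assume "D \<in> ?g ` ?S"
    then obtain A C where AC: "A < b ^ (L - k - s)" "C < b ^ s" "D = b ^ s * (b ^ k * A + v) + C" by auto
    have "b ^ k * A + v < b ^ k * (A + 1)" using assms by simp
    also have "\<dots> \<le> b ^ k * b ^ (L - k - s)" using AC by (intro mult_left_mono) auto
    finally have "b ^ k * A + v + 1 \<le> b ^ k * b ^ (L - k - s)" by simp
    then have "b ^ s * (b ^ k * A + v + 1) \<le> b ^ s * (b ^ k * b ^ (L - k - s))" by (intro mult_left_mono) auto
    also have "\<dots> = b ^ L" using assms by (simp flip: power_add)
    finally have "D < b ^ L" using AC by simp
    then show "D \<in> {D. D < b ^ L \<and> (D div b ^ s) mod b ^ k = v}"
      using AC d1[OF AC(2), of A] assms by simp
  next
    fix D assume D: "D \<in> {D. D < b ^ L \<and> (D div b ^ s) mod b ^ k = v}"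
    let ?A = "D div b ^ s div b ^ k" and ?C = "D mod b ^ s"
    have "b ^ L = b ^ (L - k - s) * (b ^ s * b ^ k)" using assms by (simp flip: power_add)
    then have "?A < b ^ (L - k - s)"
      using D b0 by (simp add: div_mult2_eq[symmetric] less_mult_imp_div_less)
    moreover have "?C < b ^ s" using b0 by simp
    moreover have "D = b ^ s * (b ^ k * ?A + v) + ?C"
    proof -
      have "b ^ k * ?A + v = D div b ^ s" using D by (metis (mono_tags, lifting) mem_Collect_eq mult_div_mod_eq)
      then show ?thesis by simp
    qed
    ultimately show "D \<in> ?g ` ?S" by (intro image_eqI[of _ _ "(?A, ?C)"]) auto
  qed
  ultimately have "card {D. D < b ^ L \<and> (D div b ^ s) mod b ^ k = v} = card ?S"
    using card_image[of ?g ?S] by simp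
  also have "\<dots> = b ^ (L - k)" using assms by (simp add: card_cartesian_product flip: power_add)
  finally show ?thesis .
qed

text \<open>Positions are sorted by their offset \<open>s\<close> within consecutive blocks of
  length \<open>L\<close>; block \<open>j\<close> starts at \<open>L * (j - 1) + 1\<close>.\<close>

lemma card_blocks:
  fixes P :: "nat \<Rightarrow> bool"
  shows "card {i \<in> {1..L * N}. P i} = (\<Sum>s<L. card {j \<in> {1..N}. P (L * (j - 1) + 1 + s)})"
proof (induction N)
  case 0
  then show ?case by simp
next
  case (Suc N)
  have "{i \<in> {1..L * Suc N}. P i} = {i \<in> {1..L * N}. P i} \<union> (\<lambda>s. L * N + 1 + s) ` {s \<in> {..<L}. P (L * N + 1 + s)}"
  proof -
    have "\<exists>s<L. i = L * N + 1 + s" if "\<not> i \<le> L * N" "i \<le> L * Suc N" for i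
      using that by (intro exI[of _ "i - L * N - 1"]) auto
    then show ?thesis by (auto simp: image_iff)
  qed
  then have "card {i \<in> {1..L * Suc N}. P i}
     = card {i \<in> {1..L * N}. P i} + card ((\<lambda>s. L * N + 1 + s) ` {s \<in> {..<L}. P (L * N + 1 + s)})"
    by (simp only:, subst card_Un_disjoint) auto
  also have "card ((\<lambda>s. L * N + 1 + s) ` {s \<in> {..<L}. P (L * N + 1 + s)}) = (\<Sum>s<L. if P (L * N + 1 + s) then 1 else 0)"
    by (subst card_image) (auto simp: inj_on_def sum.If_cases Int_def)
  also have "card {i \<in> {1..L * N}. P i} + \<dots>
     = (\<Sum>s<L. card {j \<in> {1..N}. P (L * (j - 1) + 1 + s)} + (if P (L * N + 1 + s) then 1 else 0))"
    unfolding Suc sum.distrib ..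
  also have "\<dots> = (\<Sum>s<L. card {j \<in> {1..Suc N}. P (L * (j - 1) + 1 + s)})"
  proof (rule sum.cong[OF refl])
    fix s
    have "{j \<in> {1..Suc N}. P (L * (j - 1) + 1 + s)} = {j \<in> {1..N}. P (L * (j - 1) + 1 + s)} \<union> (if P (L * N + 1 + s) then {Suc N} else {})"
      by (auto simp: le_Suc_eq)
    then show "card {j \<in> {1..N}. P (L * (j - 1) + 1 + s)} + (if P (L * N + 1 + s) then 1 else 0)
       = card {j \<in> {1..Suc N}. P (L * (j - 1) + 1 + s)}" by auto
  qed
  finally show ?case .
qed

text \<open>At most k residues modulo L are exceptional, so they contribute at most k / L to the density.\<close>
lemma density_from_blocks:
  fixes P :: "nat \<Rightarrow> bool" and p :: real and k :: nat
  assumes p: "0 \<le> p" "p \<le> 1"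
    and dens: "\<And>L s. k + s \<le> L \<Longrightarrow> 1 \<le> L \<Longrightarrow>
       (\<lambda>N. real (card {j \<in> {1..N}. P (L * (j - 1) + 1 + s)}) / real N) \<longlonglongrightarrow> p"
  shows "(\<lambda>n. real (card {i \<in> {1..n}. P i}) / real n) \<longlonglongrightarrow> p"
proof (rule LIMSEQ_I)
  fix e :: real assume e: "0 < e"
  define W where "W = (\<lambda>n. real (card {i \<in> {1..n}. P i}))"
  \<comment> \<open>This makes the share \<open>k / L\<close> of the exceptional offsets smaller
    than \<open>e / 4\<close>.\<close>
  obtain L where L: "real L > max 1 (max k (4 * k / e))" using reals_Archimedean2 by blast
  then have L1: "1 \<le> L" and Lk: "k \<le> L" and Le: "4 * k < e * L"
    using e by (auto simp: field_simps)
  define A where "A = (\<lambda>s N. real (card {j \<in> {1..N}. P (L * (j - 1) + 1 + s)}))"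
  have "\<forall>\<^sub>F N in sequentially. \<forall>s\<in>{..L - k}. \<bar>A s N / real N - p\<bar> < e / 4"
  proof (rule eventually_ball_finite)
    show "\<forall>s\<in>{..L - k}. \<forall>\<^sub>F N in sequentially. \<bar>A s N / real N - p\<bar> < e / 4"
    proof
      fix s assume "s \<in> {..L - k}"
      then have "(\<lambda>N. A s N / real N) \<longlonglongrightarrow> p" unfolding A_def using Lk L1 by (intro dens) auto
      then show "\<forall>\<^sub>F N in sequentially. \<bar>A s N / real N - p\<bar> < e / 4"
        using e tendstoD[of _ p sequentially "e / 4"] by (simp add: dist_real_def)
    qed
  qed simp
  then obtain N0 where N0: "\<And>N s. N \<ge> N0 \<Longrightarrow> s \<le> L - k \<Longrightarrow> \<bar>A s N / real N - p\<bar> < e / 4"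
    unfolding eventually_sequentially by blast
  have AN: "0 \<le> A s N \<and> A s N \<le> real N" for s N
  proof -
    have "card {j \<in> {1..N}. P (L * (j - 1) + 1 + s)} \<le> card {1..N}" by (intro card_mono) auto
    then show ?thesis by (simp add: A_def)
  qed
  \<comment> \<open>Each offset \<open>s \<le> L - k\<close> contributes an error of at most
    \<open>e / 4 * N\<close>. For the at most \<open>k\<close> others, both the count and
    \<open>p * N\<close> lie between 0 and \<open>N\<close>, so the error is at most
    \<open>N\<close>.\<close>
  have blk: "\<bar>W (L * N) - p * real (L * N)\<bar> \<le> L * (e / 4 * N) + k * N" if N: "N \<ge> max 1 N0" for N
  proof -
    have "W (L * N) - p * real (L * N) = (\<Sum>s<L. A s N - p * N)"
      unfolding W_def A_def card_blocks by (simp add: sum_subtractf)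
    also have "\<bar>\<dots>\<bar> \<le> (\<Sum>s<L. \<bar>A s N - p * N\<bar>)" by (rule sum_abs)
    also have "\<dots> \<le> (\<Sum>s<L. e / 4 * N + (if s \<le> L - k then 0 else real N))"
    proof (rule sum_mono)
      fix s
      show "\<bar>A s N - p * N\<bar> \<le> e / 4 * N + (if s \<le> L - k then 0 else real N)"
      proof (cases "s \<le> L - k")
        case True
        have "A s N - p * N = N * (A s N / real N - p)" using N by (simp add: field_simps)
        then have "\<bar>A s N - p * N\<bar> = N * \<bar>A s N / real N - p\<bar>" by (simp add: abs_mult)
        also have "\<dots> \<le> N * (e / 4)" using N0[of N s] N True by (intro mult_left_mono) auto
        finally show ?thesis using True by (simp add: mult.commute)
      next
        case False
        have "0 \<le> p * N" "p * N \<le> N" using p mult_right_mono[OF p(2), of "real N"] by auto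
        then have "\<bar>A s N - p * N\<bar> \<le> N" using AN[of s N] by auto
        moreover have "0 \<le> e / 4 * N" using e by simp
        ultimately show ?thesis using False by simp
      qed
    qed
    also have "\<dots> = L * (e / 4 * N) + card {s. s < L \<and> \<not> s \<le> L - k} * N"
      by (simp add: sum.distrib sum.If_cases Int_def)
    also have "\<dots> \<le> L * (e / 4 * N) + k * N"
    proof -
      have "{s. s < L \<and> \<not> s \<le> L - k} = {L - k<..<L}" by auto
      then have "card {s. s < L \<and> \<not> s \<le> L - k} \<le> k" by simp
      then show ?thesis by (intro add_left_mono of_nat_mono mult_right_mono) auto
    qed
    finally show ?thesis .
  qed
  \<comment> \<open>The incomplete last block has fewer than \<open>L\<close> positions.\<close>
  have rest: "W (L * (n div L)) \<le> W n \<and> W n \<le> W (L * (n div L)) + L" for n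
  proof
    have le: "L * (n div L) \<le> n" by simp
    have "card {i \<in> {1..L * (n div L)}. P i} \<le> card {i \<in> {1..n}. P i}"
      using le by (intro card_mono) (auto simp del: times_div_less_eq_dividend)
    then show "W (L * (n div L)) \<le> W n" by (simp add: W_def)
    have "{i \<in> {1..n}. P i} \<subseteq> {i \<in> {1..L * (n div L)}. P i} \<union> {L * (n div L)<..n}" by auto
    then have "card {i \<in> {1..n}. P i} \<le> card ({i \<in> {1..L * (n div L)}. P i} \<union> {L * (n div L)<..n})"
      by (intro card_mono) auto
    also have "\<dots> \<le> card {i \<in> {1..L * (n div L)}. P i} + card {L * (n div L)<..n}" by (rule card_Un_le)
    also have "card {L * (n div L)<..n} \<le> L"
    proof -
      have "n - L * (n div L) = n mod L" by (simp add: minus_mult_div_eq_mod)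
      then show ?thesis using L1 mod_less_divisor[of L n] by simp
    qed
    finally show "W n \<le> W (L * (n div L)) + L" by (simp add: W_def)
  qed
  \<comment> \<open>The first bound provides enough complete blocks for \<open>blk\<close>. The
    second makes \<open>2 * L\<close>, the cost of the incomplete block in both \<open>W n\<close>
    and \<open>p * n\<close>, smaller than \<open>e / 4 * n\<close>.\<close>
  obtain n1 where n1: "real n1 > max (L * max 1 N0) (8 * L / e)" using reals_Archimedean2 by blast
  show "\<exists>no. \<forall>n\<ge>no. norm (real (card {i \<in> {1..n}. P i}) / real n - p) < e"
  proof (intro exI[of _ n1] allI impI)
    fix n assume n: "n \<ge> n1"
    have "real n > real L * real (max 1 N0)" using n n1 by (simp add: of_nat_max)
    then have "n > L * max 1 N0" by (metis of_nat_less_iff of_nat_mult)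
    then have dv: "n div L \<ge> max 1 N0"
      using L1 by (metis less_imp_le div_le_mono nonzero_mult_div_cancel_left not_one_le_zero)
    have "8 * L / e < n" using n n1 by simp
    then have ne: "8 * L < e * n" using e by (simp add: field_simps)
    have n0: "real n > 0" using dv by (cases n) auto
    let ?N = "n div L"
    have LN: "real L * real ?N \<le> n" by (metis of_nat_le_iff of_nat_mult times_div_less_eq_dividend)
    have nL: "real n \<le> real L * real ?N + L"
    proof -
      have "n = L * ?N + n mod L" by simp
      also have "\<dots> \<le> L * ?N + L" using L1 by (intro add_left_mono less_imp_le mod_less_divisor) simp
      finally show ?thesis by (metis of_nat_add of_nat_le_iff of_nat_mult)
    qed
    have a: "\<bar>p * n - p * real (L * ?N)\<bar> \<le> L"
    proof -
      have "p * n - p * real (L * ?N) = p * (n - real L * ?N)" by (simp add: algebra_simps)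
      moreover have "p * (n - real L * ?N) \<le> n - real L * ?N" "0 \<le> p * (n - real L * ?N)"
        using p LN by (auto intro!: mult_left_le_one_le)
      ultimately show ?thesis using nL by linarith
    qed
    have b: "L * (e / 4 * ?N) \<le> e / 4 * n"
      using mult_left_mono[OF LN, of "e / 4"] e by (simp add: mult_ac)
    have c: "k * ?N \<le> e / 4 * n"
    proof -
      have "4 * (k * real ?N) \<le> e * L * ?N" using Le mult_right_mono[of "4 * k" "e * L" "real ?N"] by simp
      also have "\<dots> \<le> e * n" using mult_left_mono[OF LN, of e] e by (simp add: mult_ac)
      finally show ?thesis by simp
    qed
    have "\<bar>W n - p * n\<bar> < e * n"
      using rest[of n] blk[OF dv] a b c ne by (simp add: abs_le_iff abs_less_iff)
    moreover have "W n / n - p = (W n - p * n) / n" using n0 by (simp add: field_simps)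
    ultimately have "\<bar>W n / n - p\<bar> < e" using n0 by (simp add: pos_divide_less_eq)
    then show "norm (real (card {i \<in> {1..n}. P i}) / real n - p) < e" by (simp add: W_def)
  qed
qed

section \<open>Points outside the cover are normal\<close>

text \<open>The integer written by the first \<open>m\<close> digits of the fractional part. Through
  it, statements about digits become statements about \<open>div\<close> and \<open>mod\<close> on
  naturals.\<close>

definition scaled_frac :: "nat \<Rightarrow> real \<Rightarrow> nat \<Rightarrow> nat" where
  "scaled_frac b x m = nat \<lfloor>frac x * real b ^ m\<rfloor>"

lemma base_digit_scaled_frac: "base_digit b x j = scaled_frac b x j mod b"
  unfolding base_digit_def scaled_frac_def by (simp add: nat_mod_distrib)

lemma scaled_frac_div:
  assumes "1 \<le> b"
  shows "scaled_frac b x (m + s) div b ^ s = scaled_frac b x m"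
proof -
  have "frac x * real b ^ m = frac x * real b ^ (m + s) / real_of_int (int b ^ s)"
    using assms by (simp add: power_add)
  then have "\<lfloor>frac x * real b ^ m\<rfloor> = \<lfloor>frac x * real b ^ (m + s)\<rfloor> div int b ^ s"
    using floor_divide_real_eq_div[of "int b ^ s" "frac x * real b ^ (m + s)"] by simp
  then show ?thesis
    unfolding scaled_frac_def by (simp add: nat_div_distrib nat_power_eq)
qed

lemma scaled_frac_power: "scaled_frac (b ^ L) x j = scaled_frac b x (L * j)"
  unfolding scaled_frac_def by (simp add: power_mult)

lemma div_power_mod_power:
  fixes Y b u k L :: nat
  assumes "u + k \<le> L"
  shows "(Y mod b ^ L) div b ^ u mod b ^ k = Y div b ^ u mod b ^ k"
proof (cases "b = 0")
  case True
  then show ?thesis using assms by (cases u; cases k; cases L) auto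
next
  case False
  have "b ^ L = b ^ u * b ^ (L - u)" using assms by (simp flip: power_add)
  then have "(Y mod b ^ L) div b ^ u = (Y div b ^ u) mod b ^ (L - u)"
    using False by (simp add: mod_mult2_eq)
  then show ?thesis
    using assms by (simp add: mod_mod_cancel le_imp_power_dvd)
qed

text \<open>One digit in base \<open>b ^ L\<close> encodes a block of \<open>L\<close> digits in
  base \<open>b\<close>. For a word of length \<open>k\<close> at an offset inside a block, exactly
  \<open>b ^ (L - k)\<close> such digits match, each of frequency \<open>1 / b ^ L\<close>, so the
  word has frequency \<open>1 / b ^ k\<close> along that offset; \<open>density_from_blocks\<close>
  combines the offsets.\<close>

lemma normal_real_if_simply_normal:
  assumes simp_normal: "\<And>b d. 2 \<le> b \<Longrightarrow> d < b \<Longrightarrow>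
      (\<lambda>n. real (card {j \<in> {1..n}. base_digit b x j = d}) / real n) \<longlonglongrightarrow> 1 / real b"
  shows "normal_real x"
  unfolding normal_real_def word_occurrences_def
proof (intro allI impI)
  fix b :: nat and w :: "nat list"
  assume b: "2 \<le> b" and w: "set w \<subseteq> {..<b}"
  let ?k = "length w"
  let ?X = "scaled_frac b x"
  obtain v where v: "v < b ^ ?k"
    "\<And>E. (\<forall>t < ?k. (E div b ^ (?k - 1 - t)) mod b = w ! t) \<longleftrightarrow> E mod b ^ ?k = v"
    using digit_word_value[OF b w] by blast
  let ?P = "\<lambda>i. \<forall>j < ?k. base_digit b x (i + j) = w ! j"
  show "(\<lambda>n. real (card {i \<in> {1..n}. ?P i}) / real n) \<longlonglongrightarrow> 1 / real b ^ ?k"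
  proof (rule density_from_blocks[where k = ?k])
    show "0 \<le> 1 / real b ^ ?k" "1 / real b ^ ?k \<le> 1" using b by (auto simp: divide_le_eq_1)
    fix L s assume L: "?k + s \<le> L" "1 \<le> L"
    \<comment> \<open>The number of digits of the block that follow the word.\<close>
    let ?u = "L - ?k - s"
    define G where "G = {D. D < b ^ L \<and> (D div b ^ ?u) mod b ^ ?k = v}"
    have finG: "finite G" unfolding G_def by (rule finite_subset[of _ "{..<b ^ L}"]) auto
    have cG: "card G = b ^ (L - ?k)" unfolding G_def using b L v by (intro card_digit_pattern) auto
    \<comment> \<open>The condition \<open>1 \<le> j\<close> matters because \<open>j - 1\<close> is
      a truncated subtraction.\<close>
    have iff: "?P (L * (j - 1) + 1 + s) \<longleftrightarrow> base_digit (b ^ L) x j \<in> G" if j: "1 \<le> j" for j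
    proof -
      let ?i = "L * (j - 1) + 1 + s"
      have e: "base_digit b x (?i + t) = (?X (?i - 1 + ?k) div b ^ (?k - 1 - t)) mod b" if "t < ?k" for t
      proof -
        have eq: "?i - 1 + ?k = ?i + t + (?k - 1 - t)" using that by simp
        have "?X (?i - 1 + ?k) div b ^ (?k - 1 - t) = ?X (?i + t)"
          unfolding eq using b by (intro scaled_frac_div) simp
        then show ?thesis by (simp only: base_digit_scaled_frac)
      qed
      have "?P ?i \<longleftrightarrow> (\<forall>t < ?k. (?X (?i - 1 + ?k) div b ^ (?k - 1 - t)) mod b = w ! t)"
        using e by auto
      also have "\<dots> \<longleftrightarrow> ?X (?i - 1 + ?k) mod b ^ ?k = v" by (rule v(2))
      \<comment> \<open>The word ends at position \<open>?i - 1 + ?k\<close> and the block at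
        \<open>L * j\<close>; deleting the last \<open>?u\<close> digits of the block passes from
        one to the other.\<close>
      also have "?X (?i - 1 + ?k) = ?X (L * j) div b ^ ?u"
      proof -
        have "L * j = L * (j - 1) + L" using j by (cases j) auto
        then have eq: "L * j = ?i - 1 + ?k + ?u" using L by simp
        show ?thesis unfolding eq using b by (intro scaled_frac_div[symmetric]) simp
      qed
      also have "\<dots> mod b ^ ?k = (?X (L * j) mod b ^ L) div b ^ ?u mod b ^ ?k"
        using L by (subst div_power_mod_power) auto
      also have "?X (L * j) mod b ^ L = base_digit (b ^ L) x j"
        by (simp add: base_digit_scaled_frac scaled_frac_power)
      also have "base_digit (b ^ L) x j div b ^ ?u mod b ^ ?k = v \<longleftrightarrow> base_digit (b ^ L) x j \<in> G"
        using b by (simp add: G_def base_digit_scaled_frac)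
      finally show ?thesis .
    qed
    have bL: "2 \<le> b ^ L"
      using b L self_le_power[of b L] by linarith
    have "card {j \<in> {1..N}. ?P (L * (j - 1) + 1 + s)}
        = (\<Sum>D\<in>G. card {j \<in> {1..N}. base_digit (b ^ L) x j = D})" for N
    proof -
      have "{j \<in> {1..N}. ?P (L * (j - 1) + 1 + s)} = (\<Union>D\<in>G. {j \<in> {1..N}. base_digit (b ^ L) x j = D})"
        using iff by auto
      then show ?thesis using finG by (simp only:) (subst card_UN_disjoint, auto)
    qed
    then have "(\<lambda>N. real (card {j \<in> {1..N}. ?P (L * (j - 1) + 1 + s)}) / real N)
        = (\<lambda>N. \<Sum>D\<in>G. real (card {j \<in> {1..N}. base_digit (b ^ L) x j = D}) / real N)"
      by (simp add: sum_divide_distrib)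
    moreover have "(\<lambda>N. \<Sum>D\<in>G. real (card {j \<in> {1..N}. base_digit (b ^ L) x j = D}) / real N)
        \<longlonglongrightarrow> (\<Sum>D\<in>G. 1 / real (b ^ L))"
      using bL by (intro tendsto_sum simp_normal) (auto simp: G_def)
    moreover have "(\<Sum>D\<in>G. 1 / real (b ^ L)) = 1 / real b ^ ?k"
    proof -
      have "real b ^ L = real b ^ (L - ?k) * real b ^ ?k" using L by (simp flip: power_add)
      then show ?thesis using b cG by simp
    qed
    ultimately show "(\<lambda>N. real (card {j \<in> {1..N}. ?P (L * (j - 1) + 1 + s)}) / real N) \<longlonglongrightarrow> 1 / real b ^ ?k"
      by simp
  qed
qed

lemma word_value_base_digit:
  assumes "1 \<le> b"
  shows "word_value b n (base_digit b x) = real (scaled_frac b x n) / real b ^ n"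
proof (induction n)
  case 0
  then show ?case by (simp add: word_value_def scaled_frac_def frac_lt_1 floor_eq_iff)
next
  case (Suc n)
  have "scaled_frac b x (Suc n) = b * scaled_frac b x n + base_digit b x (Suc n)"
    using scaled_frac_div[OF assms, of x n 1] mult_div_mod_eq[of b "scaled_frac b x (Suc n)"]
    by (simp add: base_digit_scaled_frac)
  then have "real (scaled_frac b x (Suc n)) = real b * real (scaled_frac b x n) + real (base_digit b x (Suc n))"
    by (metis of_nat_add of_nat_mult)
  then show ?case using Suc assms by (simp add: word_value_def field_simps)
qed

text \<open>The first \<open>n\<close> digits of \<open>frac x\<close> form a word \<open>q\<close>
  with \<open>frac x\<close> in the half-open cylinder of length \<open>1 / b ^ n\<close> at its
  value. The open interval attached to \<open>q\<close> contains this cylinder, so outside the cover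
  every prefix of length at least \<open>sier_start m b r\<close> is balanced up to
  \<open>1 / m\<close>, for each \<open>m\<close>.\<close>

lemma normal_real_if_not_in_cover:
  assumes s: "0 < s" and x: "x \<notin> sier_cover_plus s"
  shows "normal_real x"
proof (rule normal_real_if_simply_normal)
  fix b d :: nat assume b: "2 \<le> b" and d: "d < b"
  \<comment> \<open>The parameter of the translate belonging to the integer part of
    \<open>x\<close>.\<close>
  define r where "r = s / 2 ^ (nat \<bar>\<lfloor>x\<rfloor>\<bar> + 2)"
  have y: "frac x \<notin> sier_cover r"
  proof
    assume "frac x \<in> sier_cover r"
    then have "of_int \<lfloor>x\<rfloor> + frac x \<in> sier_cover_plus s"
      unfolding sier_cover_plus_def r_def by blast
    then show False using x by (simp add: frac_def)
  qed
  have bal: "\<bar>real (card {j \<in> {1..n}. base_digit b x j = d}) / real n - 1 / real b\<bar> < 1 / real m"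
    if m: "1 \<le> m" and n: "sier_start m b r \<le> n" for m n
  proof (rule ccontr)
    assume neg: "\<not> ?thesis"
    define q where "q = restrict (base_digit b x) {1..n}"
    have q: "q \<in> {1..n} \<rightarrow>\<^sub>E {..<b}"
      using b by (auto simp: q_def base_digit_scaled_frac)
    have "{j \<in> {1..n}. q j = d} = {j \<in> {1..n}. base_digit b x j = d}" by (auto simp: q_def)
    then have c: "\<bar>real (digit_count d n q) / real n - 1 / real b\<bar> \<ge> 1 / real m"
      using neg by (simp add: digit_count_def)
    have wv: "word_value b n q = real (scaled_frac b x n) / real b ^ n"
      using b word_value_base_digit[of b n x] by (simp add: word_value_def q_def)
    have bn: "real b ^ n > 0" using b by simp
    have "real (scaled_frac b x n) \<le> frac x * real b ^ n" "frac x * real b ^ n < real (scaled_frac b x n) + 1"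
      unfolding scaled_frac_def by (auto simp: of_nat_nat)
    then have "word_value b n q \<le> frac x" "frac x < word_value b n q + 1 / real b ^ n"
      unfolding wv using bn by (auto simp: field_simps)
    then have "frac x \<in> {word_value b n q - 1 / real b ^ n <..< word_value b n q + 2 / real b ^ n}"
    proof -
      have "0 < 1 / real b ^ n" using bn by simp
      moreover have "2 / real b ^ n = 1 / real b ^ n + 1 / real b ^ n" by simp
      ultimately show ?thesis
        using \<open>word_value b n q \<le> frac x\<close> \<open>frac x < word_value b n q + 1 / real b ^ n\<close>
        unfolding greaterThanLessThan_iff by linarith
    qed
    then have "frac x \<in> sier_block b m n d" unfolding sier_block_def using q c by blast
    then have "frac x \<in> sier_cover r" unfolding sier_cover_def using b d m n by auto
    then show False using y by simp
  qed
  show "(\<lambda>n. real (card {j \<in> {1..n}. base_digit b x j = d}) / real n) \<longlonglongrightarrow> 1 / real b"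
  proof (rule LIMSEQ_I)
    fix e :: real assume "0 < e"
    then obtain m where m: "inverse (real (Suc m)) < e" using reals_Archimedean by blast
    show "\<exists>no. \<forall>n\<ge>no. norm (real (card {j \<in> {1..n}. base_digit b x j = d}) / real n - 1 / real b) < e"
      using bal[of "Suc m"] m
      by (intro exI[of _ "sier_start (Suc m) b r"]) (force simp: inverse_eq_divide)
  qed
qed

text \<open>The binary expansion read off by floors terminates, so the digit 1 has frequency 0. By
  contraposition of the preceding lemma, dyadic rationals lie in every cover.\<close>

lemma dyadic_not_normal: "\<not> normal_real (of_int z / 2 ^ n)"
proof
  let ?x = "of_int z / 2 ^ n :: real"
  assume "normal_real ?x"
  then have lim: "(\<lambda>N. real (word_occurrences 2 ?x [1] N) / real N) \<longlonglongrightarrow> 1 / 2"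
    unfolding normal_real_def by (auto dest!: spec[of _ 2] spec[of _ "[1]"])
  have "base_digit 2 ?x j = 0" if "n < j" for j
  proof -
    \<comment> \<open>Beyond position \<open>n\<close> the scaled fractional part is an even
      integer, hence its last binary digit is 0.\<close>
    have "frac ?x * 2 ^ j = of_int (2 * ((z - \<lfloor>?x\<rfloor> * 2 ^ n) * 2 ^ (j - n - 1)))"
    proof -
      have "(2::real) ^ j = 2 * 2 ^ (j - n - 1) * 2 ^ n" using that by (simp flip: power_add power_Suc)
      then show ?thesis by (simp add: frac_def field_simps)
    qed
    then have "\<lfloor>frac ?x * real 2 ^ j\<rfloor> = 2 * ((z - \<lfloor>?x\<rfloor> * 2 ^ n) * 2 ^ (j - n - 1))"
      by (metis floor_of_int of_nat_numeral)
    then show ?thesis unfolding base_digit_def by simp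
  qed
  then have sub: "{i \<in> {1..N}. \<forall>j < length [1::nat]. base_digit 2 ?x (i + j) = [1] ! j} \<subseteq> {1..n}" for N
    by (auto simp: not_less[symmetric])
  have "word_occurrences 2 ?x [1] N \<le> n" for N
    unfolding word_occurrences_def
    using card_mono[OF finite_atLeastAtMost sub[of N]] by (simp only: card_atLeastAtMost diff_Suc_1)
  then have "norm (real (word_occurrences 2 ?x [1] N) / real N) \<le> real n / real N" for N
    by (simp add: divide_right_mono)
  then have "(\<lambda>N. real (word_occurrences 2 ?x [1] N) / real N) \<longlonglongrightarrow> 0"
    by (intro Lim_null_comparison[OF _ lim_const_over_n[of "real n"]] always_eventually) auto
  then show False using lim LIMSEQ_unique by fastforce
qed

section \<open>Stretch functions and the generalized Sierpinski number\<close>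

lemma vimage_borel_of_continuous:
  fixes f :: "real \<Rightarrow> real"
  assumes "continuous_on UNIV f" "A \<in> sets borel"
  shows "f -` A \<in> sets borel"
  using measurable_sets_borel[OF borel_measurable_continuous_onI[OF assms(1)] assms(2)] .

text \<open>Links the extended-real Borel measure of the cover estimates with the real-valued
  Lebesgue measure in \<open>stretch\<close>; the unit interval supplies finiteness.\<close>

lemma emeasure_unit_vimage:
  fixes f :: "real \<Rightarrow> real"
  assumes "continuous_on UNIV f" "A \<in> sets borel"
  shows "emeasure lborel (f -` A \<inter> {0..1}) = ennreal (measure lebesgue (f -` A \<inter> {0..1}))"
    and "measure lebesgue (f -` A \<inter> {0..1}) \<le> 1"
proof -
  have B: "f -` A \<inter> {0..1} \<in> sets borel" using vimage_borel_of_continuous[OF assms] by simp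
  have "emeasure lborel (f -` A \<inter> {0..1}) \<le> emeasure lborel {0..1::real}" by (rule emeasure_mono) auto
  then have le: "emeasure lborel (f -` A \<inter> {0..1}) \<le> 1" by simp
  then have "emeasure lborel (f -` A \<inter> {0..1}) \<noteq> \<infinity>" by (auto simp: top_unique)
  then have "emeasure lborel (f -` A \<inter> {0..1}) = ennreal (measure lborel (f -` A \<inter> {0..1}))"
    by (intro emeasure_eq_ennreal_measure) simp
  then show 1: "emeasure lborel (f -` A \<inter> {0..1}) = ennreal (measure lebesgue (f -` A \<inter> {0..1}))"
    using B by (simp add: measure_completion)
  show "measure lebesgue (f -` A \<inter> {0..1}) \<le> 1"
    using le unfolding 1 by (simp add: ennreal_le_1)
qed

text \<open>Makes the real-valued \<open>Sup\<close> in \<open>stretch\<close> a genuine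
  supremum.\<close>

lemma bdd_above_stretch:
  fixes f :: "real \<Rightarrow> real"
  assumes "continuous_on UNIV f"
  shows "bdd_above {measure lebesgue (f -` A \<inter> {0..1}) | A. A \<in> sets borel \<and> emeasure lborel A \<le> ennreal \<delta>}"
  using emeasure_unit_vimage(2)[OF assms] by (intro bdd_aboveI[of _ 1]) auto

lemma measure_le_stretch:
  fixes f :: "real \<Rightarrow> real"
  assumes "continuous_on UNIV f" "A \<in> sets borel" "emeasure lborel A \<le> ennreal \<delta>"
  shows "measure lebesgue (f -` A \<inter> {0..1}) \<le> stretch f \<delta>"
  unfolding stretch_def using assms by (intro cSup_upper bdd_above_stretch) auto

lemma stretch_mono:
  fixes f :: "real \<Rightarrow> real"
  assumes cont: "continuous_on UNIV f" and le: "\<delta> \<le> \<epsilon>"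
  shows "stretch f \<delta> \<le> stretch f \<epsilon>"
  unfolding stretch_def
proof (rule cSup_subset_mono[OF _ bdd_above_stretch[OF cont]])
  show "{measure lebesgue (f -` A \<inter> {0..1}) | A. A \<in> sets borel \<and> emeasure lborel A \<le> ennreal \<delta>} \<noteq> {}"
    by (auto intro!: exI[of _ "{}"])
  show "{measure lebesgue (f -` A \<inter> {0..1}) | A. A \<in> sets borel \<and> emeasure lborel A \<le> ennreal \<delta>}
    \<subseteq> {measure lebesgue (f -` A \<inter> {0..1}) | A. A \<in> sets borel \<and> emeasure lborel A \<le> ennreal \<epsilon>}"
    using order_trans[OF _ ennreal_leI[OF le]] by blast
qed

text \<open>Absolute continuity in its epsilon-delta form: otherwise Borel-Cantelli yields a null set
  whose preimage is not null.\<close>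
lemma stretch_arbitrarily_small:
  fixes f :: "real \<Rightarrow> real"
  assumes cont: "continuous_on UNIV f" and ns: "nonsingular f" and y: "0 < y"
  shows "\<exists>\<delta>>0. stretch f \<delta> \<le> y"
proof (rule ccontr)
  assume "\<not> ?thesis"
  \<comment> \<open>Powers of 1/2 are taken as bounds because they are summable, as Borel-Cantelli
    requires.\<close>
  then have "stretch f ((1 / 2) ^ n) > y" for n :: nat by (simp add: not_le)
  then have large: "y < Sup {measure lebesgue (f -` A \<inter> {0..1}) | A.
      A \<in> sets borel \<and> emeasure lborel A \<le> ennreal ((1 / 2) ^ n)}" for n :: nat
    unfolding stretch_def .
  have "\<exists>A. A \<in> sets borel \<and> emeasure lborel A \<le> ennreal ((1 / 2) ^ n)
      \<and> y < measure lebesgue (f -` A \<inter> {0..1})" for n :: nat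
    by (rule less_cSupE[OF large[of n]]) (use exI[of _ "{}"] in force, blast)
  then obtain A where A: "\<And>n. A n \<in> sets borel" "\<And>n. emeasure lborel (A n) \<le> ennreal ((1 / 2) ^ n)"
    "\<And>n. y < measure lebesgue (f -` A n \<inter> {0..1})"
    by metis
  have fin: "emeasure lborel (A n) < \<infinity>" for n
    using A(2)[of n] by (simp add: order_le_less_trans)
  have "summable (\<lambda>n. measure lborel (A n))"
  proof (rule summable_comparison_test)
    show "summable (\<lambda>n. (1 / 2 :: real) ^ n)" by (simp add: summable_geometric)
    show "\<exists>N. \<forall>n\<ge>N. norm (measure lborel (A n)) \<le> (1 / 2) ^ n"
      using A(2) by (auto simp: measure_def intro!: enn2real_leI)
  qed
  then have "limsup A \<in> null_sets lborel"
    using A(1) fin by (intro borel_cantelli_limsup1) auto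
  then have "limsup A \<in> null_sets lebesgue" by (rule null_sets_completionI)
  then have "f -` limsup A \<in> null_sets lebesgue" using ns by (simp add: nonsingular_def)
  moreover have lsB: "limsup A \<in> sets borel" using A(1) by (auto simp: limsup_INF_SUP)
  ultimately have "f -` limsup A \<inter> {0..1} \<in> null_sets lebesgue" by (intro null_set_Int2) auto
  then have null: "emeasure lborel (f -` limsup A \<inter> {0..1}) = 0"
    using vimage_borel_of_continuous[OF cont lsB] by (auto dest!: null_setsD1)
  \<comment> \<open>The tail unions decrease to the preimage of the limit superior. Continuity from
    above would give limit 0, while \<open>?B n\<close> contains the preimage of \<open>A n\<close>,
    of measure above \<open>y\<close>.\<close>
  let ?B = "\<lambda>n. f -` (\<Union>i\<in>{n..}. A i) \<inter> {0..1}"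
  have B: "?B n \<in> sets lborel" for n
    using vimage_borel_of_continuous[OF cont, of "\<Union>i\<in>{n..}. A i"] A(1) by auto
  have "(\<Inter>n. ?B n) = f -` limsup A \<inter> {0..1}"
    by (auto simp: limsup_INF_SUP)
  moreover have "(\<lambda>n. emeasure lborel (?B n)) \<longlonglongrightarrow> emeasure lborel (\<Inter>n. ?B n)"
  proof (rule Lim_emeasure_decseq)
    show "range ?B \<subseteq> sets lborel" using B by blast
    show "decseq ?B" by (rule decseq_SucI) (auto intro: Suc_leD)
    show "emeasure lborel (?B n) \<noteq> \<infinity>" for n
      using emeasure_unit_vimage(1)[OF cont, of "\<Union>i\<in>{n..}. A i"] A(1) by simp
  qed
  ultimately have "(\<lambda>n. emeasure lborel (?B n)) \<longlonglongrightarrow> 0" using null by simp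
  moreover have "ennreal y \<le> emeasure lborel (?B n)" for n
  proof -
    have "ennreal y \<le> emeasure lborel (f -` A n \<inter> {0..1})"
      using A(3)[of n] emeasure_unit_vimage(1)[OF cont A(1)[of n]] by (simp add: ennreal_leI)
    also have "\<dots> \<le> emeasure lborel (?B n)" using B by (intro emeasure_mono) auto
    finally show ?thesis .
  qed
  ultimately have "ennreal y \<le> 0" by (intro Lim_bounded2[of _ _ 0]) auto
  then show False using y by simp
qed

text \<open>Positivity comes from the smallness of \<open>stretch\<close> near 0, together with
  boundedness of the set whose supremum is taken. The second claim is restricted to \<open>t\<close>
  strictly below the supremum, where monotonicity suffices and no continuity of
  \<open>stretch\<close> enters.\<close>

lemma stretch_inv_properties:
  fixes f :: "real \<Rightarrow> real"
  assumes cont: "continuous_on UNIV f" and ns: "nonsingular f" and y: "0 < y" "y < 1"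
  shows "0 < stretch_inv f y" and "\<And>t. t < stretch_inv f y \<Longrightarrow> stretch f t \<le> y"
proof -
  let ?S = "{t. 0 \<le> t \<and> stretch f t \<le> y}"
  obtain \<delta> where \<delta>: "0 < \<delta>" "stretch f \<delta> \<le> y" using stretch_arbitrarily_small[OF cont ns] y by blast
  have K: "compact (f ` {0..1})"
    using cont by (intro compact_continuous_image) (auto intro: continuous_on_subset)
  have bdd: "bdd_above ?S"
  proof (rule bdd_aboveI)
    fix t assume t: "t \<in> ?S"
    \<comment> \<open>For larger \<open>t\<close> the compact image of the unit interval is itself
      admissible, and its preimage is the whole interval, so \<open>stretch f t\<close> is at least
      1 and exceeds \<open>y\<close>.\<close>
    show "t \<le> measure lborel (f ` {0..1})"
    proof (rule ccontr)
      assume "\<not> ?thesis"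
      then have "emeasure lborel (f ` {0..1}) \<le> ennreal t"
        using emeasure_compact_finite[OF K] by (subst emeasure_eq_ennreal_measure) (auto intro: ennreal_leI)
      moreover have "f ` {0..1} \<in> sets borel" using K by (simp add: borel_compact)
      ultimately have "measure lebesgue (f -` (f ` {0..1}) \<inter> {0..1}) \<le> stretch f t"
        by (intro measure_le_stretch cont)
      moreover have "f -` (f ` {0..1}) \<inter> {0..1} = {0..1}" by auto
      ultimately have "1 \<le> stretch f t" by simp
      then show False using t assms by auto
    qed
  qed
  have "\<delta> \<le> stretch_inv f y" unfolding stretch_inv_def using \<delta> by (intro cSup_upper bdd) auto
  then show "0 < stretch_inv f y" using \<delta> by simp
  fix t assume "t < stretch_inv f y"
  then obtain u where "u \<in> ?S" "t < u"
    unfolding stretch_inv_def using \<delta> by (subst (asm) less_cSup_iff[OF _ bdd]) (auto intro: exI[of _ \<delta>])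
  then show "stretch f t \<le> y" using stretch_mono[OF cont, of t u] by auto
qed

text \<open>The cover with parameter \<open>s\<close> has measure at most \<open>s / 2\<close>,
  strictly below the generalized inverse, so \<open>stretch f (s / 2) \<le> y\<close>
  applies.\<close>

lemma emeasure_vimage_cover:
  fixes f :: "real \<Rightarrow> real"
  assumes cont: "continuous_on UNIV f" and ns: "nonsingular f" and y: "0 < y" "y < 1"
  shows "emeasure lborel (f -` sier_cover_plus (stretch_inv f y) \<inter> {0..1}) \<le> ennreal y"
proof -
  let ?s = "stretch_inv f y"
  have s: "0 < ?s" "stretch f (?s / 2) \<le> y" using stretch_inv_properties[OF assms] by auto
  have U: "sier_cover_plus ?s \<in> sets borel" using open_sier_cover_plus by simp
  have "measure lebesgue (f -` sier_cover_plus ?s \<inter> {0..1}) \<le> y"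
    using measure_le_stretch[OF cont U emeasure_sier_cover_plus[OF s(1)]] s(2) by simp
  then show ?thesis unfolding emeasure_unit_vimage(1)[OF cont U] by (rule ennreal_leI)
qed

section \<open>Density of the preimages and the strict measure bound\<close>

lemma dyadic_between:
  fixes a c :: real
  assumes "a < c"
  obtains z :: int and n :: nat where "a < of_int z / 2 ^ n" "of_int z / 2 ^ n < c"
proof -
  obtain n where n: "(1 / 2 :: real) ^ n < c - a"
    using real_arch_pow_inv[of "c - a" "1/2"] assms by auto
  let ?z = "\<lfloor>a * 2 ^ n\<rfloor> + 1"
  have "a * 2 ^ n < of_int ?z" "of_int ?z \<le> a * 2 ^ n + 1" by linarith+
  then have "a < of_int ?z / 2 ^ n" "of_int ?z / 2 ^ n \<le> a + 1 / 2 ^ n"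
    by (auto simp: field_simps)
  then show ?thesis using n that[of ?z n] by (simp add: power_divide)
qed

text \<open>On a ball inside \<open>V\<close> the function is not constant, since otherwise the
  preimage of a single point would contain the ball and not be null. By the intermediate value
  property it takes a dyadic value there, and dyadic values are covered.\<close>

lemma vimage_cover_dense:
  fixes f :: "real \<Rightarrow> real"
  assumes cont: "continuous_on UNIV f" and ns: "nonsingular f" and s: "0 < s"
    and V: "open V" "V \<noteq> {}"
  shows "\<exists>x\<in>V. f x \<in> sier_cover_plus s"
proof -
  obtain x0 e where e: "0 < e" "ball x0 e \<subseteq> V" using V open_contains_ball by (metis ex_in_conv)
  let ?J = "ball x0 e"
  have "\<exists>u\<in>?J. f u \<noteq> f x0"
  proof (rule ccontr)
    assume "\<not> ?thesis"
    then have "?J \<subseteq> f -` {f x0}" by auto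
    moreover have "f -` {f x0} \<in> null_sets lebesgue"
    proof -
      have "{f x0} \<in> null_sets lborel" by (simp add: null_sets_def)
      then show ?thesis using ns by (simp add: nonsingular_def null_sets_completionI)
    qed
    ultimately have "negligible ?J"
      by (intro negligible_subset[of "f -` {f x0}" ?J]) (simp_all add: negligible_iff_null_sets)
    then show False using e(1) open_not_negligible[of ?J] by simp
  qed
  then obtain u v where uv: "u \<in> ?J" "v \<in> ?J" "f u < f v"
    using e(1) by (metis centre_in_ball linorder_neq_iff)
  obtain z n where t: "f u < of_int z / 2 ^ n" "of_int z / 2 ^ n < f v"
    using dyadic_between[OF uv(3)] .
  have "connected (f ` ?J)"
    using cont by (intro connected_continuous_image) (auto intro: continuous_on_subset)
  then have "of_int z / 2 ^ n \<in> f ` ?J"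
    by (rule connectedD_interval[of _ "f u" "f v"]) (use uv t in auto)
  then show ?thesis
    using dyadic_not_normal[of z n] normal_real_if_not_in_cover[OF s] e(2) by (metis imageE subsetD)
qed

text \<open>The measures of the sets may add up to 1; the overlap of the first two makes the inequality
  strict.\<close>
lemma overlapping_cover_misses_point:
  fixes E :: "nat \<Rightarrow> real set" and r :: real
  assumes openE: "\<And>k. 1 \<le> k \<Longrightarrow> open (E k)"
    and mE: "\<And>k. 1 \<le> k \<Longrightarrow> emeasure lborel (E k \<inter> {0..1}) \<le> ennreal (r / 2 ^ k)"
    and overlap: "{0<..<1} \<inter> E 1 \<inter> E 2 \<noteq> {}"
    and r: "0 < r" "r \<le> 1"
  shows "\<exists>x\<in>{0..<1}. x \<notin> (\<Union>k\<in>{1..}. E k)"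
proof -
  define V where "V = {0<..<1} \<inter> E 1 \<inter> E 2"
  have "open V" unfolding V_def by (intro open_Int openE) auto
  moreover have "V \<noteq> {}" using overlap unfolding V_def .
  ultimately have Vpos: "emeasure lborel V > 0"
    using open_not_negligible[of V]
    by (auto simp: negligible_iff_null_sets null_sets_def zero_less_iff_neq_zero)
  have Vfin: "emeasure lborel V \<le> 1"
  proof -
    have "V \<subseteq> {0..1}" by (auto simp: V_def)
    from emeasure_mono[OF this, of lborel] show ?thesis by simp
  qed
  define \<epsilon> where "\<epsilon> = measure lborel V"
  have V\<epsilon>: "emeasure lborel V = ennreal \<epsilon>"
    unfolding \<epsilon>_def using Vfin by (intro emeasure_eq_ennreal_measure) (auto simp: top_unique)
  have \<epsilon>0: "0 < \<epsilon>" using Vpos V\<epsilon> by simp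
  show ?thesis
  proof (rule ccontr)
    assume "\<not> ?thesis"
    then have sub: "{0..<1} \<subseteq> (\<Union>k\<in>{1..}. E k)" by blast
    \<comment> \<open>The overlap \<open>V\<close> is removed from the second set only;
      \<open>E 1\<close> still covers it. The bounds \<open>g\<close> therefore sum to
      \<open>r - \<epsilon>\<close>.\<close>
    define E' where "E' = (\<lambda>k. if k = 2 then E 2 \<inter> {0..1} - V else E k \<inter> {0..1})"
    define g where "g = (\<lambda>k. r / 2 ^ k - (if k = 2 then \<epsilon> else 0))"
    have E'B: "E' k \<in> sets lborel" if "1 \<le> k" for k
      using openE[OF that] openE[of 2] \<open>open V\<close> by (auto simp: E'_def)
    have mE': "emeasure lborel (E' k) \<le> ennreal (g k) \<and> 0 \<le> g k" if k: "1 \<le> k" for k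
    proof (cases "k = 2")
      case True
      have VE: "V \<subseteq> E 2 \<inter> {0..1}" by (auto simp: V_def)
      have "E 2 \<inter> {0..1} \<in> sets borel" "V \<in> sets borel" using openE[of 2] \<open>open V\<close> by auto
      then have "emeasure lborel (E 2 \<inter> {0..1} - V) = emeasure lborel (E 2 \<inter> {0..1}) - ennreal \<epsilon>"
        using VE Vfin V\<epsilon> by (subst emeasure_Diff) auto
      also have "\<dots> \<le> ennreal (r / 2 ^ 2) - ennreal \<epsilon>" using mE[of 2] by (intro ennreal_minus_mono) auto
      also have "\<dots> = ennreal (r / 2 ^ 2 - \<epsilon>)" using \<epsilon>0 by (intro ennreal_minus) simp
      finally have 1: "emeasure lborel (E' k) \<le> ennreal (g k)" using True by (simp add: E'_def g_def)
      have "ennreal \<epsilon> \<le> emeasure lborel (E 2 \<inter> {0..1})"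
        using VE openE[of 2] unfolding V\<epsilon>[symmetric] by (intro emeasure_mono) auto
      also have "\<dots> \<le> ennreal (r / 2 ^ 2)" using mE[of 2] by simp
      finally have "\<epsilon> \<le> r / 2 ^ 2" using r(1) by (subst (asm) ennreal_le_iff) auto
      then show ?thesis using 1 True by (simp add: g_def)
    next
      case False
      then show ?thesis using mE[OF k] r(1) by (simp add: E'_def g_def)
    qed
    \<comment> \<open>Index \<open>i\<close> stands for \<open>k = i + 1\<close>, so the correction
      at \<open>k = 2\<close> appears at \<open>i = 1\<close>.\<close>
    have "(\<lambda>i. r / 2 * (1 / 2) ^ i - (if i = 1 then \<epsilon> else 0)) sums (r / 2 * (1 / (1 - 1 / 2)) - \<epsilon>)"
      by (intro sums_diff sums_mult geometric_sums sums_single) simp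
    then have gs: "(\<lambda>i. g (Suc i)) sums (r - \<epsilon>)"
      by (simp add: g_def power_divide numeral_2_eq_2)
    have "{0..<1} \<subseteq> (\<Union>i. E' (Suc i))"
    proof
      fix x :: real assume x: "x \<in> {0..<1}"
      then obtain k where k: "1 \<le> k" "x \<in> E k" using sub by auto
      have "x \<in> E' k \<or> x \<in> E' 1" using k x by (auto simp: E'_def V_def)
      then show "x \<in> (\<Union>i. E' (Suc i))"
        using k by (cases k) auto
    qed
    then have "emeasure lborel {0..<1::real} \<le> emeasure lborel (\<Union>i. E' (Suc i))"
      using E'B by (intro emeasure_mono) auto
    also have "\<dots> \<le> ennreal (r - \<epsilon>)"
      using E'B mE' gs by (intro emeasure_UN_le_sums[where g = "\<lambda>i. g (Suc i)"]) auto
    finally have "1 \<le> ennreal (r - \<epsilon>)" by simp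
    then show False using r(2) \<epsilon>0 by (simp add: ennreal_ge_1)
  qed
qed

section \<open>The least uncovered point\<close>

theorem theorem3p2:
  fixes F :: "(real \<Rightarrow> real) set" and f :: "nat \<Rightarrow> real \<Rightarrow> real" and r :: real
  assumes "F = f ` {1..}"
    and "\<And>g. g \<in> F \<Longrightarrow> continuous_on UNIV g"
    and "\<And>g. g \<in> F \<Longrightarrow> nonsingular g"
    and "0 < r" and "r \<le> 1"
  shows "{x \<in> {0..1}. x \<notin> family_cover f r} \<noteq> {}
    \<and> sierpinski_number f r \<in> {0..<1}
    \<and> family_normal F (sierpinski_number f r)"
proof -
  have cont: "continuous_on UNIV (f k)" and ns: "nonsingular (f k)" if "1 \<le> k" for k
    using assms that by auto
  define s where "s = (\<lambda>k. stretch_inv (f k) (r / 2 ^ k))"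
  define E where "E = (\<lambda>k. f k -` sier_cover_plus (s k))"
  have y: "0 < r / 2 ^ k" "r / 2 ^ k < 1" if "1 \<le> k" for k
  proof -
    have "(1::real) < 2 ^ k" using that by simp
    then show "r / 2 ^ k < 1" using assms(4,5) by (simp add: divide_less_eq_1)
  qed (use assms in auto)
  have s: "0 < s k" if "1 \<le> k" for k
    unfolding s_def using that by (intro stretch_inv_properties cont ns y)
  have openE: "open (E k)" if "1 \<le> k" for k
    unfolding E_def using open_sier_cover_plus cont[OF that] by (rule open_vimage)
  have mE: "emeasure lborel (E k \<inter> {0..1}) \<le> ennreal (r / 2 ^ k)" if "1 \<le> k" for k
    unfolding E_def s_def using that by (intro emeasure_vimage_cover cont ns y)
  have cover: "family_cover f r = (\<Union>k\<in>{1..}. E k)"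
    by (simp add: family_cover_def E_def s_def)
  define S where "S = {x \<in> {0..1}. x \<notin> family_cover f r}"
  have "closed S"
  proof -
    have "S = {0..1} - (\<Union>k\<in>{1..}. E k)" by (auto simp: S_def cover)
    then show ?thesis using openE by (simp add: closed_Diff open_UN)
  qed
  have "{0<..<1} \<inter> E 1 \<inter> E 2 \<noteq> {}"
  proof -
    \<comment> \<open>Density is applied twice: first to the open interval, then to its nonempty
      open intersection with \<open>E 1\<close>.\<close>
    have "\<exists>x\<in>{0<..<1}. f 1 x \<in> sier_cover_plus (s 1)"
      by (intro vimage_cover_dense cont ns s) auto
    then have "{0<..<1} \<inter> E 1 \<noteq> {}" by (auto simp: E_def)
    then have "\<exists>x\<in>{0<..<1} \<inter> E 1. f 2 x \<in> sier_cover_plus (s 2)"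
      using openE by (intro vimage_cover_dense cont ns s) auto
    then show ?thesis by (auto simp: E_def)
  qed
  then have "\<exists>x\<in>{0..<1}. x \<notin> (\<Union>k\<in>{1..}. E k)"
    using openE mE assms(4,5) by (intro overlapping_cover_misses_point)
  then have "\<exists>x<1. x \<in> S" by (force simp: S_def cover)
  then obtain x1 where x1: "x1 \<in> S" "x1 < 1" by blast
  have bdd: "bdd_below S" by (rule bdd_belowI[of _ 0]) (auto simp: S_def)
  have \<xi>: "Inf S \<in> S" using x1 bdd \<open>closed S\<close> by (intro closed_contains_Inf) auto
  \<comment> \<open>An uncovered point below 1 keeps the infimum away from the right
    endpoint.\<close>
  have "Inf S \<le> x1" using x1 bdd by (intro cInf_lower)
  then have "Inf S \<in> {0..<1}" using \<xi> x1 by (auto simp: S_def)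
  moreover have "family_normal F (Inf S)"
    unfolding family_normal_def
  proof
    fix g assume "g \<in> F"
    then obtain k where k: "1 \<le> k" "g = f k" using assms(1) by auto
    have "Inf S \<notin> E k" using \<xi> k by (auto simp: S_def cover)
    then show "normal_real (g (Inf S))"
      using normal_real_if_not_in_cover[OF s[OF k(1)]] k by (simp add: E_def)
  qed
  ultimately show ?thesis
    using x1 unfolding sierpinski_number_def S_def[symmetric] by auto
qed

end
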